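(* Let $n\ge 3$, $p\ge 1$, and let $M^n$ be an $n$-dimensional Riemannian submanifold of an $(n+p)$-dimensional real space form $N^{n+p}(\widetilde c)$ of constant sectional curvature $\widetilde c$. Then at every point of $M$ $$\rho\le \delta_C(n-1)+\widetilde c,$$ where $\rho$ is the normalized scalar curvature of $M$ and $\delta_C(n-1)$ is the normalized $\delta$-Casorati curvature of $M$. Moreover, equality holds (at every point of $M$) if and only if $M^n$ is an invariantly quasi-umbilical submanifold with trivial normal connection in $N^{n+p}(\widetilde c)$ such that, with respect to suitable orthonormal tangent frames $\{e_1,\dots,e_n\}$ and orthonormal normal frames $\{e_{n+1},\dots,e_{n+p}\}$, the shape operators $A_r=A_{e_r}$, $r\in\{n+1,\dots,n+p\}$, take the form $$A_{n+1}=\operatorname{diag}(\underbrace{\lambda,\lambda,\dots,\lambda}_{n-1},2\lambda),\qquad A_{n+2}=\cdots=A_{n+p}=0.$$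
   Context: $M^n$ carries the induced metric $g$; $h$ is its second fundamental form, and for a normal vector $Z$ the shape operator $A_Z$ is defined by $g(A_ZX,Y)=\overline g(h(X,Y),Z)$, where $\overline g$ is the metric of $N^{n+p}(\widetilde c)$. For an orthonormal frame $e_1,\dots,e_n$ tangent to $M$ and $e_{n+1},\dots,e_{n+p}$ normal to $M$, put $h_{ij}^r=\overline g(h(e_i,e_j),e_r)$. The Casorati curvature of $M$ is $$\mathcal C=\frac1n\sum_{r=n+1}^{n+p}\sum_{i,j=1}^n (h_{ij}^r)^2 .$$ For an $l$-dimensional subspace $L\subset T_xM$, $l\ge 2$, with orthonormal basis $e_1,\dots,e_l$, its Casorati curvature is $$\mathcal C(L)=\frac1l\sum_{r=n+1}^{n+p}\sum_{i,j=1}^l (h_{ij}^r)^2 .$$ The normalized $\delta$-Casorati curvature $\delta_C(n-1)$ is defined at $x\in M$ by $$[\delta_C(n-1)]_x=\tfrac12\,\mathcal C_x+\frac{n+1}{2n}\inf\{\mathcal C(L)\mid L\text{ a hyperplane of }T_xM\}.$$ The scalar curvature is $\tau=\sum_{i<j}K(e_i\wedge e_j)$, where $K$ is the sectional curvature of $M$, and the normalized scalar curvature is $\rho=\frac{2\tau}{n(n-1)}$. $M^n$ is invariantly quasi-umbilical if (at each point) there exist $p$ mutually orthogonal unit normal vectors $\xi_{n+1},\dots,\xi_{n+p}$ such that the shape operators with respect to all directions $\xi_r$ have an eigenvalue of multiplicity (at least) $n-1$ and for each $\xi_r$ the distinguished eigendirection is the same. The normal connection is trivial if its curvature tensor $R^\perp$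 vanishes. "Suitable frames" is understood pointwise: at each point $x\in M$ there are orthonormal bases of $T_xM$ and $T_x^\perp M$ and a real number $\lambda=\lambda(x)$ (possibly $0$) for which the displayed form holds. *)

theory Defs
  imports "HOL-Analysis.Analysis"
begin

section \<open>Smooth manifolds and Riemannian metrics\<close>

primrec Ck_on :: "nat \<Rightarrow> 'a::real_normed_vector set \<Rightarrow> ('a \<Rightarrow> 'b::real_normed_vector) \<Rightarrow> bool" where
  "Ck_on 0 = (\<lambda>S f. continuous_on S f)"
| "Ck_on (Suc k) = (\<lambda>S f. (\<forall>x\<in>S. f differentiable (at x)) \<and>
     (\<forall>v. Ck_on k S (\<lambda>x. frechet_derivative f (at x) v)))"

definition smooth_on :: "'a::real_normed_vector set \<Rightarrow> ('a \<Rightarrow> 'b::real_normed_vector) \<Rightarrow> bool" where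
  "smooth_on S f \<longleftrightarrow> (\<forall>k. Ck_on k S f)"

text \<open>A chart is a pair of its domain and its coordinate map; the points of a manifold
  form a whole type (Hausdorff and second countable by its type class), and its dimension is that
  of the Euclidean model space \<open>'e\<close>.\<close>

type_synonym ('m, 'e) chart = "'m set \<times> ('m \<Rightarrow> 'e)"

definition chart_inv :: "('m, 'e) chart \<Rightarrow> 'e \<Rightarrow> 'm" where
  "chart_inv c = inv_into (fst c) (snd c)"

definition transition :: "('m, 'e) chart \<Rightarrow> ('m, 'e) chart \<Rightarrow> 'e \<Rightarrow> 'e" where
  "transition c d = snd d \<circ> chart_inv c"

definition smooth_atlas :: "('m::topological_space, 'e::euclidean_space) chart set \<Rightarrow> bool" where
  "smooth_atlas A \<longleftrightarrow>
     (\<Union>c\<in>A. fst c) = UNIV \<and>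
     (\<forall>c\<in>A. open (fst c) \<and> open (snd c ` fst c) \<and>
        homeomorphism (fst c) (snd c ` fst c) (snd c) (chart_inv c)) \<and>
     (\<forall>c\<in>A. \<forall>d\<in>A. smooth_on (snd c ` (fst c \<inter> fst d)) (transition c d))"

text \<open>\<open>G y X Y\<close> is the inner product at \<open>y\<close>, in coordinates, of the vectors \<open>X\<close>, \<open>Y\<close>.\<close>

type_synonym 'e metric = "'e \<Rightarrow> 'e \<Rightarrow> 'e \<Rightarrow> real"

definition local_riemannian_metric :: "'e::euclidean_space set \<Rightarrow> 'e metric \<Rightarrow> bool" where
  "local_riemannian_metric V G \<longleftrightarrow>
     (\<forall>y\<in>V. bilinear (G y) \<and> (\<forall>X Y. G y X Y = G y Y X) \<and> (\<forall>X. X \<noteq> 0 \<longrightarrow> G y X X > 0)) \<and>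
     (\<forall>X Y. smooth_on V (\<lambda>y. G y X Y))"

text \<open>A metric on a manifold is given by its expressions in all charts, subject to the
  transformation law of covariant 2-tensors.\<close>

definition riemannian_metric ::
  "('m, 'e::euclidean_space) chart set \<Rightarrow> (('m, 'e) chart \<Rightarrow> 'e metric) \<Rightarrow> bool" where
  "riemannian_metric A G \<longleftrightarrow>
     (\<forall>c\<in>A. local_riemannian_metric (snd c ` fst c) (G c)) \<and>
     (\<forall>c\<in>A. \<forall>d\<in>A. \<forall>x \<in> fst c \<inter> fst d. \<forall>X Y.
        G c (snd c x) X Y =
        G d (snd d x) (frechet_derivative (transition c d) (at (snd c x)) X)
                      (frechet_derivative (transition c d) (at (snd c x)) Y))"

text \<open>The tangent space at \<open>x\<close> is identified with the model space by means of a chosen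
  chart around \<open>x\<close>; all the notions below are independent of this choice.\<close>

definition chart_at :: "('m, 'e) chart set \<Rightarrow> 'm \<Rightarrow> ('m, 'e) chart" where
  "chart_at A x = (SOME c. c \<in> A \<and> x \<in> fst c)"

definition coords :: "('m, 'e) chart set \<Rightarrow> 'm \<Rightarrow> 'e" where
  "coords A x = snd (chart_at A x) x"

section \<open>Levi-Civita connection and curvature\<close>

text \<open>The Koszul formula for constant coordinate fields.\<close>

definition christoffel :: "'e::euclidean_space metric \<Rightarrow> 'e \<Rightarrow> 'e \<Rightarrow> 'e \<Rightarrow> 'e" where
  "christoffel G y X Y = (THE W. \<forall>Z. G y W Z =
     (frechet_derivative (\<lambda>q. G q Y Z) (at y) X
      + frechet_derivative (\<lambda>q. G q X Z) (at y) Y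
      - frechet_derivative (\<lambda>q. G q X Y) (at y) Z) / 2)"

text \<open>Covariant derivative, in the direction of the constant coordinate field \<open>X\<close>, of a vector
  field \<open>V\<close> along the map \<open>f\<close>, for the Levi-Civita connection of the metric \<open>G\<close> on the target.
  For \<open>f = id\<close> this is the Levi-Civita connection itself.\<close>

definition cov_deriv ::
  "'f::euclidean_space metric \<Rightarrow> ('e::euclidean_space \<Rightarrow> 'f) \<Rightarrow> 'e \<Rightarrow> ('e \<Rightarrow> 'f) \<Rightarrow> 'e \<Rightarrow> 'f" where
  "cov_deriv G f X V u =
     frechet_derivative V (at u) X + christoffel G (f u) (frechet_derivative f (at u) X) (V u)"

text \<open>\<open>R(X,Y)Z = \<nabla>\<^sub>X \<nabla>\<^sub>Y Z - \<nabla>\<^sub>Y \<nabla>\<^sub>X Z\<close>, the vectors being extended to constant coordinate fields,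
  so that \<open>[X,Y] = 0\<close>.\<close>

definition curvature :: "'e::euclidean_space metric \<Rightarrow> 'e \<Rightarrow> 'e \<Rightarrow> 'e \<Rightarrow> 'e \<Rightarrow> 'e" where
  "curvature G y X Y Z =
     cov_deriv G id X (cov_deriv G id Y (\<lambda>_. Z)) y - cov_deriv G id Y (cov_deriv G id X (\<lambda>_. Z)) y"

definition sectional_curvature :: "'e::euclidean_space metric \<Rightarrow> 'e \<Rightarrow> 'e \<Rightarrow> 'e \<Rightarrow> real" where
  "sectional_curvature G y X Y =
     G y (curvature G y X Y Y) X / (G y X X * G y Y Y - (G y X Y)\<^sup>2)"

definition real_space_form ::
  "('m::topological_space, 'e::euclidean_space) chart set \<Rightarrow> (('m, 'e) chart \<Rightarrow> 'e metric) \<Rightarrow> real \<Rightarrow> bool"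
  where
  "real_space_form B G c \<longleftrightarrow> smooth_atlas B \<and> riemannian_metric B G \<and>
     (\<forall>y X Y. X \<noteq> Y \<and> independent {X, Y} \<longrightarrow>
        sectional_curvature (G (chart_at B y)) (coords B y) X Y = c)"

text \<open>Frames are indexed from 1 on. Scalar and Casorati curvatures are computed in a chosen
  orthonormal frame; their values do not depend on the choice.\<close>

definition orthonormal_basis :: "('e::euclidean_space \<Rightarrow> 'e \<Rightarrow> real) \<Rightarrow> 'e set \<Rightarrow> (nat \<Rightarrow> 'e) \<Rightarrow> bool" where
  "orthonormal_basis b L e \<longleftrightarrow> span (e ` {1..dim L}) = L \<and>
     (\<forall>i\<in>{1..dim L}. \<forall>j\<in>{1..dim L}. b (e i) (e j) = (if i = j then 1 else 0))"

definition scalar_curvature :: "'e::euclidean_space metric \<Rightarrow> 'e \<Rightarrow> real" where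
  "scalar_curvature g u =
     (let e = (SOME e. orthonormal_basis (g u) UNIV e)
      in \<Sum>j = 1..DIM('e). \<Sum>i = 1..<j. sectional_curvature g u (e i) (e j))"

section \<open>Riemannian submanifolds\<close>

definition smooth_immersion ::
  "('m::topological_space, 'e::euclidean_space) chart set \<Rightarrow>
   ('w::topological_space, 'f::euclidean_space) chart set \<Rightarrow> ('m \<Rightarrow> 'w) \<Rightarrow> bool" where
  "smooth_immersion A B F \<longleftrightarrow> continuous_on UNIV F \<and>
     (\<forall>c\<in>A. \<forall>d\<in>B. let U = snd c ` (fst c \<inter> F -` fst d); f = snd d \<circ> F \<circ> chart_inv c
        in smooth_on U f \<and> (\<forall>u\<in>U. inj (frechet_derivative f (at u))))"

definition local_rep ::
  "('m, 'e) chart set \<Rightarrow> ('w, 'f) chart set \<Rightarrow> ('m \<Rightarrow> 'w) \<Rightarrow> 'm \<Rightarrow> 'e \<Rightarrow> 'f" where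
  "local_rep A B F x = snd (chart_at B (F x)) \<circ> F \<circ> chart_inv (chart_at A x)"

text \<open>A notion \<open>Q G f u\<close> for an immersion \<open>f\<close> between open subsets of Euclidean spaces, at the
  point \<open>u\<close>, with metric \<open>G\<close> on the target, is transported to the point \<open>x\<close> of a manifold
  immersed by \<open>F\<close>.\<close>

definition at_point ::
  "('m, 'e) chart set \<Rightarrow> ('w, 'f) chart set \<Rightarrow> (('w, 'f) chart \<Rightarrow> 'f metric) \<Rightarrow> ('m \<Rightarrow> 'w) \<Rightarrow>
   ('f metric \<Rightarrow> ('e \<Rightarrow> 'f) \<Rightarrow> 'e \<Rightarrow> 'q) \<Rightarrow> 'm \<Rightarrow> 'q" where
  "at_point A B G F Q x = Q (G (chart_at B (F x))) (local_rep A B F x) (coords A x)"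

definition induced_metric ::
  "'f::euclidean_space metric \<Rightarrow> ('e::euclidean_space \<Rightarrow> 'f) \<Rightarrow> 'e metric" where
  "induced_metric G f u X Y =
     G (f u) (frechet_derivative f (at u) X) (frechet_derivative f (at u) Y)"

definition normal_space ::
  "'f::euclidean_space metric \<Rightarrow> ('e::euclidean_space \<Rightarrow> 'f) \<Rightarrow> 'e \<Rightarrow> 'f set" where
  "normal_space G f u = {W. \<forall>X. G (f u) W (frechet_derivative f (at u) X) = 0}"

definition normal_part ::
  "'f::euclidean_space metric \<Rightarrow> ('e::euclidean_space \<Rightarrow> 'f) \<Rightarrow> 'e \<Rightarrow> 'f \<Rightarrow> 'f" where
  "normal_part G f u V =
     (THE W. W \<in> normal_space G f u \<and> V - W \<in> range (frechet_derivative f (at u)))"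

definition second_fundamental_form ::
  "'f::euclidean_space metric \<Rightarrow> ('e::euclidean_space \<Rightarrow> 'f) \<Rightarrow> 'e \<Rightarrow> 'e \<Rightarrow> 'e \<Rightarrow> 'f" where
  "second_fundamental_form G f u X Y =
     normal_part G f u (cov_deriv G f X (\<lambda>w. frechet_derivative f (at w) Y) u)"

definition shape_operator ::
  "'f::euclidean_space metric \<Rightarrow> ('e::euclidean_space \<Rightarrow> 'f) \<Rightarrow> 'e \<Rightarrow> 'f \<Rightarrow> 'e \<Rightarrow> 'e" where
  "shape_operator G f u Z X =
     (THE W. \<forall>Y. induced_metric G f u W Y = G (f u) (second_fundamental_form G f u X Y) Z)"

text \<open>Normal frames are indexed by \<open>n + 1, \<dots>, n + p\<close>, where \<open>n\<close> and \<open>n + p\<close> are the dimensions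
  of the submanifold and of the ambient manifold.\<close>

definition normal_frame ::
  "'f::euclidean_space metric \<Rightarrow> ('e::euclidean_space \<Rightarrow> 'f) \<Rightarrow> 'e \<Rightarrow> (nat \<Rightarrow> 'f) \<Rightarrow> bool" where
  "normal_frame G f u \<xi> \<longleftrightarrow>
     (\<forall>r \<in> {DIM('e) + 1..DIM('f)}. \<xi> r \<in> normal_space G f u \<and>
        (\<forall>s \<in> {DIM('e) + 1..DIM('f)}. G (f u) (\<xi> r) (\<xi> s) = (if r = s then 1 else 0)))"

definition normalized_scalar_curvature ::
  "'f::euclidean_space metric \<Rightarrow> ('e::euclidean_space \<Rightarrow> 'f) \<Rightarrow> 'e \<Rightarrow> real" where
  "normalized_scalar_curvature G f u =
     2 * scalar_curvature (induced_metric G f) u / (real DIM('e) * (real DIM('e) - 1))"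

text \<open>Casorati curvature of the subspace \<open>L\<close> of the tangent space; \<open>L = UNIV\<close> gives the Casorati
  curvature of the submanifold.\<close>

definition casorati_curvature ::
  "'e::euclidean_space set \<Rightarrow> 'f::euclidean_space metric \<Rightarrow> ('e \<Rightarrow> 'f) \<Rightarrow> 'e \<Rightarrow> real" where
  "casorati_curvature L G f u =
     (let e = (SOME e. orthonormal_basis (induced_metric G f u) L e);
          \<xi> = (SOME \<xi>. normal_frame G f u \<xi>)
      in 1 / real (dim L) * (\<Sum>r = DIM('e) + 1..DIM('f). \<Sum>i = 1..dim L. \<Sum>j = 1..dim L.
           (G (f u) (second_fundamental_form G f u (e i) (e j)) (\<xi> r))\<^sup>2))"

definition delta_casorati ::
  "'f::euclidean_space metric \<Rightarrow> ('e::euclidean_space \<Rightarrow> 'f) \<Rightarrow> 'e \<Rightarrow> real" where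
  "delta_casorati G f u =
     1 / 2 * casorati_curvature UNIV G f u
     + (real DIM('e) + 1) / (2 * real DIM('e))
       * (INF L \<in> {L. subspace L \<and> dim L = DIM('e) - 1}. casorati_curvature L G f u)"

text \<open>The distinguished eigendirection of a shape operator with an eigenvalue of multiplicity at
  least \<open>n - 1\<close> is the eigendirection orthogonal to (an \<open>(n - 1)\<close>-dimensional part of) that
  eigenspace; in the totally umbilical case every direction may serve.\<close>

definition invariantly_quasi_umbilical ::
  "'f::euclidean_space metric \<Rightarrow> ('e::euclidean_space \<Rightarrow> 'f) \<Rightarrow> 'e \<Rightarrow> bool" where
  "invariantly_quasi_umbilical G f u \<longleftrightarrow>
     (\<exists>\<xi> v. normal_frame G f u \<xi> \<and> v \<noteq> 0 \<and>
       (\<forall>r \<in> {DIM('e) + 1..DIM('f)}. \<exists>a b.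
          dim {X. shape_operator G f u (\<xi> r) X = a *\<^sub>R X} \<ge> DIM('e) - 1 \<and>
          {X. induced_metric G f u X v = 0} \<subseteq> {X. shape_operator G f u (\<xi> r) X = a *\<^sub>R X} \<and>
          shape_operator G f u (\<xi> r) v = b *\<^sub>R v))"

definition normal_connection ::
  "'f::euclidean_space metric \<Rightarrow> ('e::euclidean_space \<Rightarrow> 'f) \<Rightarrow> 'e \<Rightarrow> ('e \<Rightarrow> 'f) \<Rightarrow> 'e \<Rightarrow> 'f" where
  "normal_connection G f X \<xi> u = normal_part G f u (cov_deriv G f X \<xi> u)"

text \<open>Again \<open>X\<close>, \<open>Y\<close> are constant coordinate fields, so there is no bracket term.\<close>

definition normal_curvature ::
  "'f::euclidean_space metric \<Rightarrow> ('e::euclidean_space \<Rightarrow> 'f) \<Rightarrow> 'e \<Rightarrow> 'e \<Rightarrow> ('e \<Rightarrow> 'f) \<Rightarrow> 'e \<Rightarrow> 'f" where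
  "normal_curvature G f X Y \<xi> u =
     normal_connection G f X (normal_connection G f Y \<xi>) u
     - normal_connection G f Y (normal_connection G f X \<xi>) u"

definition normal_curvature_vanishes ::
  "'f::euclidean_space metric \<Rightarrow> ('e::euclidean_space \<Rightarrow> 'f) \<Rightarrow> 'e \<Rightarrow> bool" where
  "normal_curvature_vanishes G f u \<longleftrightarrow>
     (\<forall>U \<xi> X Y. open U \<and> u \<in> U \<and> smooth_on U \<xi> \<and> (\<forall>w\<in>U. \<xi> w \<in> normal_space G f w)
        \<longrightarrow> normal_curvature G f X Y \<xi> u = 0)"

definition special_shape_operators ::
  "'f::euclidean_space metric \<Rightarrow> ('e::euclidean_space \<Rightarrow> 'f) \<Rightarrow> 'e \<Rightarrow> bool" where
  "special_shape_operators G f u \<longleftrightarrow>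
     (\<exists>e \<xi> a. orthonormal_basis (induced_metric G f u) UNIV e \<and> normal_frame G f u \<xi> \<and>
        (\<forall>i \<in> {1..DIM('e)}. shape_operator G f u (\<xi> (DIM('e) + 1)) (e i) =
           (if i = DIM('e) then 2 * a else a) *\<^sub>R e i) \<and>
        (\<forall>r \<in> {DIM('e) + 2..DIM('f)}. \<forall>X. shape_operator G f u (\<xi> r) X = 0))"

end

theory Submission imports Defs begin

text \<open>At a point \<open>u\<close>, the Gauss equation turns the claim into an inequality for the second fundamental
  form \<open>h\<close>. Let \<open>L\<close> be a hyperplane, \<open>e\<^sub>1, \<dots>, e\<^sub>n\<close> an orthonormal basis whose first \<open>n - 1\<close> members
  span \<open>L\<close>, and write \<open>S\<close>, \<open>S\<^sub>L\<close> for the sums of \<open>\<bar>h(e\<^sub>i, e\<^sub>j)\<bar>\<^sup>2\<close> over \<open>i, j \<le> n\<close> and \<open>i, j \<le> n - 1\<close>, and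
  \<open>H = \<Sum>\<^sub>i h(e\<^sub>i, e\<^sub>i)\<close>. The claim for \<open>L\<close> becomes \<open>2 \<bar>H\<bar>\<^sup>2 \<le> (n + 1) (S + S\<^sub>L)\<close>. With \<open>t = H / (n + 1)\<close>,
  \<open>D = diag(1, \<dots>, 1, 2)\<close> and \<open>d\<^sub>i\<^sub>j = h(e\<^sub>i, e\<^sub>j) - D\<^sub>i\<^sub>j t\<close>, the difference \<open>S + S\<^sub>L - 2 \<bar>H\<bar>\<^sup>2 / (n + 1)\<close> is
  exactly \<open>\<Sum>\<^sub>i\<^sub>,\<^sub>j\<^sub>\<le>\<^sub>n \<bar>d\<^sub>i\<^sub>j\<bar>\<^sup>2 + \<Sum>\<^sub>i\<^sub>,\<^sub>j\<^sub>\<le>\<^sub>n\<^sub>-\<^sub>1 \<bar>d\<^sub>i\<^sub>j\<bar>\<^sup>2\<close>. By compactness the infimum over \<open>L\<close> is attained, so equality means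
  \<open>h(e\<^sub>i, e\<^sub>j) = D\<^sub>i\<^sub>j t\<close> in some orthonormal basis. Then every shape operator is a multiple of \<open>D\<close>, and the
  normal connection is flat by the Ricci equation, since the curvature tensor of the ambient space is
  determined by its constant sectional curvature.\<close>

section \<open>Inner products on a Euclidean space\<close>

text \<open>The matrix D is forced. Componentwise, S + S_L is a squared norm in which diagonal
  entries with i < n count twice and the entry (n, n) once. For it the trace is represented by
  diag(1/2, ..., 1/2, 1) = D / 2, whose squared norm is (n + 1) / 2. So the bound is Cauchy-Schwarz,
  and the identity displays its remainder. Attainment of the infimum is what lets equality single
  out a hyperplane, and with it a frame. The rest is shaped by the encoding. A metric is a family of
  bilinear forms on the model space, unrelated to its built-in inner product, and Christoffel
  symbols, normal parts and shape operators are given by \<open>THE\<close>. They are recovered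
  through Riesz representation for the form at hand, and differentiability in the base point is
  obtained from the representing equation, with no inverse matrix. The ambient and the induced
  metric are instances of one locale, so connection and curvature are treated once. All geometry
  takes place in one pair of charts around one point.\<close>

locale inner_form =
  fixes b :: "'a::euclidean_space \<Rightarrow> 'a \<Rightarrow> real"
  assumes bilinear_form: "bilinear b"
    and form_commute: "b x y = b y x"
    and form_pos: "x \<noteq> 0 \<Longrightarrow> b x x > 0"
begin

lemmas form_simps =
  bilinear_ladd[OF bilinear_form] bilinear_radd[OF bilinear_form]
  bilinear_lmul[OF bilinear_form] bilinear_rmul[OF bilinear_form]
  bilinear_lsub[OF bilinear_form] bilinear_rsub[OF bilinear_form]
  bilinear_lzero[OF bilinear_form] bilinear_rzero[OF bilinear_form]
  bilinear_lneg[OF bilinear_form] bilinear_rneg[OF bilinear_form]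

lemma linear_form_left: "linear (\<lambda>x. b x y)" and linear_form_right: "linear (b x)"
  using bilinear_form by (auto simp: bilinear_def)

lemma form_sum_left: "b (\<Sum>i\<in>I. g i) y = (\<Sum>i\<in>I. b (g i) y)"
  and form_sum_right: "b y (\<Sum>i\<in>I. g i) = (\<Sum>i\<in>I. b y (g i))"
  using linear_sum[OF linear_form_left] linear_sum[OF linear_form_right] by auto

lemma form_nonneg: "b x x \<ge> 0"
  by (cases "x = 0") (auto simp: form_simps less_imp_le[OF form_pos])

lemma form_eq_0_iff: "b x x = 0 \<longleftrightarrow> x = 0"
  using form_pos[of x] by (cases "x = 0") (auto simp: form_simps)

lemma form_eqI: "(\<And>z. b x z = b y z) \<Longrightarrow> x = y"
  using form_eq_0_iff[of "x - y"] by (simp add: form_simps)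

text \<open>The index set is a parameter so that tangent frames on 1..n, frames of hyperplanes on
  1..n-1 and normal frames on n+1..n+p are all instances, and frames can be restricted or extended
  without reindexing.\<close>

definition orthonormal :: "nat set \<Rightarrow> (nat \<Rightarrow> 'a) \<Rightarrow> bool" where
  "orthonormal I e \<longleftrightarrow> (\<forall>i\<in>I. \<forall>j\<in>I. b (e i) (e j) = (if i = j then 1 else 0))"

lemma orthonormalD: "orthonormal I e \<Longrightarrow> i \<in> I \<Longrightarrow> j \<in> I \<Longrightarrow> b (e i) (e j) = (if i = j then 1 else 0)"
  by (auto simp: orthonormal_def)

lemma orthonormal_subset: "orthonormal I e \<Longrightarrow> J \<subseteq> I \<Longrightarrow> orthonormal J e"
  unfolding orthonormal_def by blast

lemma orthonormal_expansion:
  assumes "orthonormal I e" "finite I" "x \<in> span (e ` I)"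
  shows "x = (\<Sum>i\<in>I. b x (e i) *\<^sub>R e i)"
proof -
  have "linear (\<lambda>x. \<Sum>i\<in>I. b x (e i) *\<^sub>R e i)"
    by (intro linearI) (simp_all add: form_simps scaleR_add_left sum.distrib scaleR_sum_right)
  moreover have "(\<Sum>i\<in>I. b (e j) (e i) *\<^sub>R e i) = e j" if "j \<in> I" for j
  proof -
    have "(\<Sum>i\<in>I. b (e j) (e i) *\<^sub>R e i) = (\<Sum>i\<in>I. if i = j then e i else 0)"
      using assms(1) that by (intro sum.cong) (auto simp: orthonormal_def)
    then show ?thesis
      using assms(2) that by simp
  qed
  ultimately show ?thesis
    using linear_eq_on_span[OF linear_ident _ _ assms(3)] by fastforce
qed

lemma orthonormal_inj_on: "orthonormal I e \<Longrightarrow> inj_on e I"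
  unfolding inj_on_def orthonormal_def by (metis zero_neq_one)

lemma orthogonal_span:
  assumes "\<And>y. y \<in> S \<Longrightarrow> b x y = 0" "z \<in> span S"
  shows "b x z = 0"
proof -
  have "subspace {z. b x z = 0}"
    by (auto simp: subspace_def form_simps)
  then have "span S \<subseteq> {z. b x z = 0}"
    using assms(1) by (intro span_minimal) auto
  then show ?thesis
    using assms(2) by auto
qed

lemma orthonormal_independent:
  assumes "orthonormal I e"
  shows "independent (e ` I)"
proof
  assume "dependent (e ` I)"
  then obtain i where i: "i \<in> I" "e i \<in> span (e ` I - {e i})"
    by (auto simp: dependent_def)
  have "b (e i) (e i) = 0"
    by (rule orthogonal_span[OF _ i(2)]) (use assms i in \<open>auto simp: orthonormal_def\<close>)
  then show False
    using assms i by (auto simp: orthonormal_def)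
qed

lemma orthonormal_dim:
  assumes "orthonormal I e"
  shows "dim (span (e ` I)) = card I"
  using orthonormal_independent[OF assms] orthonormal_inj_on[OF assms]
  by (simp add: dim_eq_card_independent card_image)

lemma orthonormal_spans:
  assumes "orthonormal I e" "e ` I \<subseteq> L" "subspace L" "card I = dim L"
  shows "span (e ` I) = L"
  by (intro subspace_dim_equal)
     (use assms orthonormal_dim[OF assms(1)] in \<open>auto simp: span_minimal\<close>)

text \<open>One Gram-Schmidt step: the frame spans a proper subspace of \<open>L\<close>, so some
  vector of \<open>L\<close> has a nonzero residual after projection, which is then
  normalised.\<close>

lemma orthonormal_insert:
  assumes "orthonormal I e" "finite I" "e ` I \<subseteq> L" "subspace L" "card I < dim L" "k \<notin> I"
  shows "\<exists>z\<in>L. orthonormal (insert k I) (e(k := z))"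
proof -
  have sub: "span (e ` I) \<subseteq> L"
    using assms by (simp add: span_minimal)
  have "span (e ` I) \<noteq> L"
    using orthonormal_dim[OF assms(1)] assms(5) by auto
  then obtain y where y: "y \<in> L" "y \<notin> span (e ` I)"
    using sub by blast
  define w where "w = y - (\<Sum>i\<in>I. b y (e i) *\<^sub>R e i)"
  have s: "(\<Sum>i\<in>I. b y (e i) *\<^sub>R e i) \<in> span (e ` I)"
    by (intro span_sum span_mul span_base) auto
  have w0: "w \<noteq> 0"
    using y s unfolding w_def by auto
  have wL: "w \<in> L"
    using y s sub assms(4) unfolding w_def by (meson subsetD subspace_diff)
  have orth: "b w (e j) = 0" if "j \<in> I" for j
  proof -
    have "(\<Sum>i\<in>I. b y (e i) * b (e i) (e j)) = (\<Sum>i\<in>I. if i = j then b y (e i) else 0)"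
      using assms(1) that by (intro sum.cong) (auto simp: orthonormal_def)
    then show ?thesis
      using assms(2) that by (simp add: w_def form_simps form_sum_left)
  qed
  define z where "z = (1 / sqrt (b w w)) *\<^sub>R w"
  have "b z z = 1"
    using form_pos[OF w0] by (simp add: z_def form_simps real_sqrt_mult[symmetric] flip: power2_eq_square)
  moreover have "b z (e j) = 0" "b (e j) z = 0" if "j \<in> I" for j
    using orth[OF that] form_commute[of w "e j"] by (simp_all add: z_def form_simps)
  ultimately have "orthonormal (insert k I) (e(k := z))"
    using assms(1,6) by (auto simp: orthonormal_def)
  moreover have "z \<in> L"
    using wL assms(4) by (simp add: z_def subspace_mul)
  ultimately show ?thesis by blast
qed

text \<open>Keeping prescribed members at prescribed indices is the point: later a basis of a
  hyperplane, a single unit vector at index n, the image of a tangent frame, or one unit normal has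
  to be completed.\<close>

lemma orthonormal_extend:
  assumes "finite J" "I \<subseteq> J" "orthonormal I e" "e ` I \<subseteq> L" "subspace L" "card J \<le> dim L"
  shows "\<exists>e'. orthonormal J e' \<and> (\<forall>i\<in>I. e' i = e i) \<and> e' ` J \<subseteq> L"
proof -
  have "finite K \<Longrightarrow> K \<inter> I = {} \<Longrightarrow> card (K \<union> I) \<le> dim L \<Longrightarrow>
      \<exists>e'. orthonormal (K \<union> I) e' \<and> (\<forall>i\<in>I. e' i = e i) \<and> e' ` (K \<union> I) \<subseteq> L" for K
  proof (induction K rule: finite_induct)
    case empty
    then show ?case using assms by auto
  next
    case (insert k K)
    have fin: "finite (K \<union> I)"
      using insert.hyps(1) finite_subset[OF assms(2,1)] by simp
    have k: "k \<notin> K \<union> I"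
      using insert by auto
    have card: "card (K \<union> I) < dim L"
      using insert.prems(2) fin k by simp
    then obtain e' where e': "orthonormal (K \<union> I) e'" "\<forall>i\<in>I. e' i = e i" "e' ` (K \<union> I) \<subseteq> L"
      using insert by auto
    from orthonormal_insert[OF e'(1) fin e'(3) assms(5) card k]
    obtain z where z: "z \<in> L" "orthonormal (insert k (K \<union> I)) (e'(k := z))" by blast
    show ?case
    proof (intro exI[of _ "e'(k := z)"] conjI)
      show "orthonormal (insert k K \<union> I) (e'(k := z))"
        using z(2) by simp
      show "\<forall>i\<in>I. (e'(k := z)) i = e i"
        using e'(2) k by auto
      show "(e'(k := z)) ` (insert k K \<union> I) \<subseteq> L"
        using z(1) e'(3) k by auto
    qed
  qed
  from this[of "J - I"] show ?thesis
    using assms by (auto simp: Un_absorb2)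
qed

lemma orthonormal_exists:
  assumes "finite J" "subspace L" "card J = dim L"
  obtains e where "orthonormal J e" "e ` J \<subseteq> L" "span (e ` J) = L"
  using orthonormal_extend[of J "{}" undefined L] assms orthonormal_spans[of J _ L]
  by (auto simp: orthonormal_def)

text \<open>Expand one argument in the second basis, swap the sums, and recombine in the first: both
  expansions have the same coefficients \<open>b (e i) (e' j)\<close>. Values may be vectors, so the
  lemma also covers the trace of the second fundamental form.\<close>

lemma trace_invariant:
  assumes "bilinear \<beta>" "orthonormal I e" "orthonormal J e'" "finite I" "finite J"
    and "span (e ` I) = span (e' ` J)"
  shows "(\<Sum>i\<in>I. \<beta> (e i) (e i)) = (\<Sum>j\<in>J. \<beta> (e' j) (e' j))"
proof -
  have lin: "linear (\<beta> x)" "linear (\<lambda>x. \<beta> x y)" for x y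
    using assms(1) by (auto simp: bilinear_def)
  have 1: "e i = (\<Sum>j\<in>J. b (e i) (e' j) *\<^sub>R e' j)" if "i \<in> I" for i
    by (rule orthonormal_expansion) (use assms that in \<open>auto intro: span_base simp flip: assms(6)\<close>)
  have 2: "e' j = (\<Sum>i\<in>I. b (e i) (e' j) *\<^sub>R e i)" if "j \<in> J" for j
    using orthonormal_expansion[OF assms(2,4), of "e' j"] assms(6) that
    by (auto intro: span_base simp: form_commute[of "e' j"])
  have "(\<Sum>i\<in>I. \<beta> (e i) (e i)) = (\<Sum>i\<in>I. \<beta> (e i) (\<Sum>j\<in>J. b (e i) (e' j) *\<^sub>R e' j))"
    using 1 by (intro sum.cong) auto
  also have "\<dots> = (\<Sum>i\<in>I. \<Sum>j\<in>J. b (e i) (e' j) *\<^sub>R \<beta> (e i) (e' j))"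
    by (simp add: linear_sum[OF lin(1)] linear_scale[OF lin(1)])
  also have "\<dots> = (\<Sum>j\<in>J. \<Sum>i\<in>I. b (e i) (e' j) *\<^sub>R \<beta> (e i) (e' j))"
    by (rule sum.swap)
  also have "\<dots> = (\<Sum>j\<in>J. \<beta> (\<Sum>i\<in>I. b (e i) (e' j) *\<^sub>R e i) (e' j))"
    by (simp add: linear_sum[OF lin(2)] linear_scale[OF lin(2)])
  also have "\<dots> = (\<Sum>j\<in>J. \<beta> (e' j) (e' j))"
    using 2 by (intro sum.cong) auto
  finally show ?thesis .
qed

lemma parseval:
  assumes "orthonormal I e" "finite I" "x \<in> span (e ` I)"
  shows "b x x = (\<Sum>i\<in>I. (b x (e i))\<^sup>2)"
proof -
  have "b x x = b x (\<Sum>i\<in>I. b x (e i) *\<^sub>R e i)"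
    using orthonormal_expansion[OF assms] by simp
  then show ?thesis
    by (simp add: form_simps form_sum_right power2_eq_square)
qed

text \<open>Every \<open>THE\<close> that defines a Christoffel symbol, a tangential part or a shape
  operator is resolved by this existence and uniqueness.\<close>

lemma riesz:
  assumes "linear \<phi>"
  shows "\<exists>!w. \<forall>z. b w z = \<phi> z"
proof -
  obtain e where e: "orthonormal {1..DIM('a)} e" "span (e ` {1..DIM('a)}) = UNIV"
    by (rule orthonormal_exists[of "{1..DIM('a)}" UNIV]) auto
  have "b (\<Sum>i = 1..DIM('a). \<phi> (e i) *\<^sub>R e i) z = \<phi> z" for z
  proof -
    have "\<phi> z = \<phi> (\<Sum>i = 1..DIM('a). b z (e i) *\<^sub>R e i)"
      using orthonormal_expansion[OF e(1), of z] e(2) by simp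
    also have "\<dots> = b (\<Sum>i = 1..DIM('a). \<phi> (e i) *\<^sub>R e i) z"
      by (simp add: linear_sum[OF assms] linear_scale[OF assms] form_sum_left form_simps
          form_commute[of z] mult.commute)
    finally show ?thesis by simp
  qed
  moreover have "w = w'" if "\<forall>z. b w z = \<phi> z" "\<forall>z. b w' z = \<phi> z" for w w'
    by (rule form_eqI) (simp add: that)
  ultimately show ?thesis by blast
qed

lemma continuous_on_form:
  "continuous_on S g \<Longrightarrow> continuous_on S h \<Longrightarrow> continuous_on S (\<lambda>x. b (g x) (h x))"
  using bounded_bilinear.continuous_on bilinear_form
  unfolding bilinear_conv_bounded_bilinear by blast

text \<open>The constant is the minimum over the compact Euclidean unit sphere. It links the form to
  the norm in which limits and boundedness are stated.\<close>

lemma coercive: "\<exists>m>0. \<forall>x. b x x \<ge> m * (norm x)\<^sup>2"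
proof -
  have "compact (sphere (0::'a) 1)" "sphere (0::'a) 1 \<noteq> {}"
    by (auto simp: sphere_eq_empty)
  moreover have "continuous_on (sphere 0 1) (\<lambda>x. b x x)"
    by (intro continuous_on_form continuous_intros)
  ultimately obtain x0 where x0: "x0 \<in> sphere 0 1" "\<forall>y\<in>sphere 0 1. b x0 x0 \<le> b y y"
    using continuous_attains_inf by blast
  have "b x0 x0 * (norm x)\<^sup>2 \<le> b x x" for x
  proof (cases "x = 0")
    case False
    then have "b x0 x0 \<le> b ((1 / norm x) *\<^sub>R x) ((1 / norm x) *\<^sub>R x)"
      using x0(2) by simp
    then show ?thesis
      using False by (simp add: form_simps field_simps power2_eq_square)
  qed (simp add: form_simps)
  moreover have "b x0 x0 > 0"
    using x0(1) by (intro form_pos) auto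
  ultimately show ?thesis by blast
qed

end

section \<open>Differential calculus\<close>

abbreviation ddir :: "('a::real_normed_vector \<Rightarrow> 'b::real_normed_vector) \<Rightarrow> 'a \<Rightarrow> 'a \<Rightarrow> 'b" where
  "ddir f x v \<equiv> frechet_derivative f (at x) v"

lemma ddir_eq: "(f has_derivative f') (at x) \<Longrightarrow> ddir f x v = f' v"
  using frechet_derivative_at by metis

lemma differentiable_has_ddir: "f differentiable (at x) \<Longrightarrow> (f has_derivative ddir f x) (at x)"
  using frechet_derivative_works by blast

lemma linear_ddir: "f differentiable (at x) \<Longrightarrow> linear (ddir f x)"
  by (rule linear_frechet_derivative)

text \<open>\<open>frechet_derivative\<close> is a choice among the derivatives of a function;
  functions that agree near \<open>x\<close> have the same derivatives there, hence the same
  choice.\<close>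

lemma ddir_cong_open:
  assumes "open S" "x \<in> S" "\<And>y. y \<in> S \<Longrightarrow> f y = g y"
  shows "ddir f x v = ddir g x v"
proof -
  have "(f has_derivative d) (at x) \<longleftrightarrow> (g has_derivative d) (at x)" for d
    using assms has_derivative_transform_within_open[of f d x UNIV S g]
      has_derivative_transform_within_open[of g d x UNIV S f] by auto
  then show ?thesis
    by (simp add: frechet_derivative_def)
qed

lemma differentiable_cong_open:
  assumes "open S" "x \<in> S" "\<And>y. y \<in> S \<Longrightarrow> f y = g y" "g differentiable (at x)"
  shows "f differentiable (at x)"
  using assms has_derivative_transform_within_open[of g _ x UNIV S f]
  unfolding differentiable_def by metis

section \<open>Product rule for point-dependent bilinear maps\<close>

lemma bilinear_expansion:
  fixes \<beta> :: "'b::euclidean_space \<Rightarrow> 'c::euclidean_space \<Rightarrow> 'd::real_vector"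
  assumes "bilinear \<beta>"
  shows "\<beta> a b = (\<Sum>i\<in>Basis. \<Sum>j\<in>Basis. ((a \<bullet> i) * (b \<bullet> j)) *\<^sub>R \<beta> i j)"
proof -
  have lin: "linear (\<beta> x)" "linear (\<lambda>x. \<beta> x y)" for x y
    using assms by (auto simp: bilinear_def)
  have "\<beta> a b = \<beta> (\<Sum>i\<in>Basis. (a \<bullet> i) *\<^sub>R i) b"
    by (simp add: euclidean_representation)
  also have "\<dots> = (\<Sum>i\<in>Basis. (a \<bullet> i) *\<^sub>R \<beta> i b)"
    by (simp add: linear_sum[OF lin(2)] linear_scale[OF lin(2)])
  also have "\<dots> = (\<Sum>i\<in>Basis. (a \<bullet> i) *\<^sub>R \<beta> i (\<Sum>j\<in>Basis. (b \<bullet> j) *\<^sub>R j))"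
    by (simp add: euclidean_representation)
  finally show ?thesis
    by (simp add: linear_sum[OF lin(1)] linear_scale[OF lin(1)] scaleR_sum_right)
qed

text \<open>The hypothesis speaks of constant arguments. Expanding both arguments in
  \<open>Basis\<close> turns the field into a finite sum of products of scalar coordinates with such
  terms, where the ordinary product rule applies. It serves the metric, the Christoffel symbols and
  the differential of the immersion.\<close>

lemma has_derivative_bilinear_field:
  fixes \<beta> :: "'b::real_normed_vector \<Rightarrow> 'c::euclidean_space \<Rightarrow> 'd::euclidean_space \<Rightarrow> 'r::real_normed_vector"
    and f :: "'a::real_normed_vector \<Rightarrow> 'b"
  assumes "open V" "f u \<in> V" "\<And>y. y \<in> V \<Longrightarrow> bilinear (\<beta> y)"
    and diff: "\<And>a b. (\<lambda>y. \<beta> y a b) differentiable (at (f u))"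
    and f: "(f has_derivative f') (at u)"
    and A: "(A has_derivative A') (at u)" and B: "(B has_derivative B') (at u)"
  shows "((\<lambda>w. \<beta> (f w) (A w) (B w)) has_derivative
    (\<lambda>X. ddir (\<lambda>y. \<beta> y (A u) (B u)) (f u) (f' X) + \<beta> (f u) (A' X) (B u) + \<beta> (f u) (A u) (B' X))) (at u)"
proof -
  have ev: "eventually (\<lambda>w. f w \<in> V) (at u)"
    using assms(1,2) has_derivative_continuous[OF f]
    by (metis continuous_within topological_tendstoD)
  have b: "\<beta> y a b = (\<Sum>i\<in>Basis. \<Sum>j\<in>Basis. ((a \<bullet> i) * (b \<bullet> j)) *\<^sub>R \<beta> y i j)" if "y \<in> V" for y a b
    using bilinear_expansion[OF assms(3)[OF that]] .
  have d0: "((\<lambda>w. \<beta> w i j) has_derivative ddir (\<lambda>y. \<beta> y i j) (f u)) (at (f u))" for i j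
    by (rule differentiable_has_ddir[OF diff])
  have d: "((\<lambda>w. \<beta> (f w) i j) has_derivative (\<lambda>X. ddir (\<lambda>y. \<beta> y i j) (f u) (f' X))) (at u)" for i j
    using diff_chain_at[OF f d0] by (simp add: o_def)
  \<comment> \<open>Folds the coordinate expansion of the derivative back into a derivative with
    frozen arguments.\<close>
  have E: "ddir (\<lambda>y. \<beta> y a b) (f u) Y
      = (\<Sum>i\<in>Basis. \<Sum>j\<in>Basis. ((a \<bullet> i) * (b \<bullet> j)) *\<^sub>R ddir (\<lambda>y. \<beta> y i j) (f u) Y)" for a b Y
  proof -
    have "ddir (\<lambda>y. \<beta> y a b) (f u) Y
        = ddir (\<lambda>y. \<Sum>i\<in>Basis. \<Sum>j\<in>Basis. ((a \<bullet> i) * (b \<bullet> j)) *\<^sub>R \<beta> y i j) (f u) Y"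
      by (rule ddir_cong_open[OF assms(1,2) b])
    also have "\<dots> = (\<Sum>i\<in>Basis. \<Sum>j\<in>Basis. ((a \<bullet> i) * (b \<bullet> j)) *\<^sub>R ddir (\<lambda>y. \<beta> y i j) (f u) Y)"
      by (rule ddir_eq) (intro derivative_intros d0)
    finally show ?thesis .
  qed
  have "((\<lambda>w. \<Sum>i\<in>Basis. \<Sum>j\<in>Basis. ((A w \<bullet> i) * (B w \<bullet> j)) *\<^sub>R \<beta> (f w) i j) has_derivative
      (\<lambda>X. \<Sum>i\<in>Basis. \<Sum>j\<in>Basis. ((A u \<bullet> i) * (B u \<bullet> j)) *\<^sub>R ddir (\<lambda>y. \<beta> y i j) (f u) (f' X)
         + ((A u \<bullet> i) * (B' X \<bullet> j) + (A' X \<bullet> i) * (B u \<bullet> j)) *\<^sub>R \<beta> (f u) i j)) (at u)"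
    by (intro derivative_intros A B d)
  also have "(\<lambda>X. \<Sum>i\<in>Basis. \<Sum>j\<in>Basis. ((A u \<bullet> i) * (B u \<bullet> j)) *\<^sub>R ddir (\<lambda>y. \<beta> y i j) (f u) (f' X)
         + ((A u \<bullet> i) * (B' X \<bullet> j) + (A' X \<bullet> i) * (B u \<bullet> j)) *\<^sub>R \<beta> (f u) i j) =
      (\<lambda>X. ddir (\<lambda>y. \<beta> y (A u) (B u)) (f u) (f' X) + \<beta> (f u) (A' X) (B u) + \<beta> (f u) (A u) (B' X))"
  proof (rule ext)
    fix X
    show "(\<Sum>i\<in>Basis. \<Sum>j\<in>Basis. ((A u \<bullet> i) * (B u \<bullet> j)) *\<^sub>R ddir (\<lambda>y. \<beta> y i j) (f u) (f' X)
         + ((A u \<bullet> i) * (B' X \<bullet> j) + (A' X \<bullet> i) * (B u \<bullet> j)) *\<^sub>R \<beta> (f u) i j) =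
      ddir (\<lambda>y. \<beta> y (A u) (B u)) (f u) (f' X) + \<beta> (f u) (A' X) (B u) + \<beta> (f u) (A u) (B' X)"
      unfolding E[of "A u" "B u"] b[OF assms(2), of "A' X" "B u"] b[OF assms(2), of "A u" "B' X"]
      by (simp add: scaleR_add_left sum.distrib add_ac)
  qed
  finally have *: "((\<lambda>w. \<Sum>i\<in>Basis. \<Sum>j\<in>Basis. ((A w \<bullet> i) * (B w \<bullet> j)) *\<^sub>R \<beta> (f w) i j) has_derivative
      (\<lambda>X. ddir (\<lambda>y. \<beta> y (A u) (B u)) (f u) (f' X) + \<beta> (f u) (A' X) (B u) + \<beta> (f u) (A u) (B' X))) (at u)" .
  show ?thesis
  proof (rule has_derivative_transform_eventually[OF *])
    show "\<forall>\<^sub>F w in at u. (\<Sum>i\<in>Basis. \<Sum>j\<in>Basis. ((A w \<bullet> i) * (B w \<bullet> j)) *\<^sub>R \<beta> (f w) i j) = \<beta> (f w) (A w) (B w)"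
      using ev by eventually_elim (rule b[symmetric])
    show "(\<Sum>i\<in>Basis. \<Sum>j\<in>Basis. ((A u \<bullet> i) * (B u \<bullet> j)) *\<^sub>R \<beta> (f u) i j) = \<beta> (f u) (A u) (B u)"
      by (rule b[OF assms(2), symmetric])
  qed simp
qed

section \<open>Symmetry of second derivatives\<close>

text \<open>The mean value theorem, applied to the increment of \<open>f\<close> in direction
  \<open>t w\<close> along the segment in direction \<open>v\<close>, leaves a difference of two
  values of \<open>ddir f\<close> in direction \<open>v\<close> near \<open>x\<close>.
  Differentiability of that derivative at \<open>x\<close> alone then gives the limit.\<close>

lemma second_difference_tendsto:
  fixes f :: "'a::real_normed_vector \<Rightarrow> real"
  assumes "open S" "x \<in> S" "\<And>y. y \<in> S \<Longrightarrow> f differentiable (at y)"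
    and P: "((\<lambda>y. ddir f y v) has_derivative P') (at x)"
  shows "((\<lambda>t. (f (x + t *\<^sub>R v + t *\<^sub>R w) - f (x + t *\<^sub>R v) - f (x + t *\<^sub>R w) + f x) / t\<^sup>2) \<longlongrightarrow> P' w) (at_right 0)"
    (is "(?q \<longlongrightarrow> _) _")
proof (rule tendstoI)
  fix e :: real assume "e > 0"
  define K where "K = norm v + norm w + 1"
  have K: "K > 0" using norm_ge_zero[of v] norm_ge_zero[of w] unfolding K_def by linarith
  \<comment> \<open>Two linear approximations are used at distance at most \<open>t * K\<close>;
    after division by \<open>t\<close> their errors sum to at most 2 e' K, that is 2e/3.\<close>
  define e' where "e' = e / (3 * K)"
  have e': "e' > 0" using \<open>e > 0\<close> K by (simp add: e'_def)
  have lin: "linear P'"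
    using P has_derivative_linear by blast
  obtain d where d: "d > 0"
    "\<And>y. norm (y - x) < d \<Longrightarrow> norm (ddir f y v - ddir f x v - P' (y - x)) \<le> e' * norm (y - x)"
    using P e' unfolding has_derivative_at_alt by metis
  obtain r where r: "r > 0" "ball x r \<subseteq> S"
    using assms(1,2) open_contains_ball by blast
  have "dist (?q t) (P' w) < e" if t: "0 < t" "t < min d r / K" for t
  proof -
    have tK: "t * K < d" "t * K < r"
      using t K by (auto simp: field_simps)
    have small: "norm (a *\<^sub>R v + b *\<^sub>R w) < d" "norm (a *\<^sub>R v + b *\<^sub>R w) < r"
        "norm (a *\<^sub>R v + b *\<^sub>R w) \<le> t * K" if "0 \<le> a" "a \<le> t" "0 \<le> b" "b \<le> t" for a b
    proof -
      have "norm (a *\<^sub>R v + b *\<^sub>R w) \<le> a * norm v + b * norm w"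
        using norm_triangle_ineq[of "a *\<^sub>R v" "b *\<^sub>R w"] that by simp
      also have "\<dots> \<le> t * norm v + t * norm w"
        using that by (intro add_mono mult_right_mono) auto
      also have "\<dots> \<le> t * K"
        using t by (simp add: K_def algebra_simps)
      finally show "norm (a *\<^sub>R v + b *\<^sub>R w) \<le> t * K" .
      then show "norm (a *\<^sub>R v + b *\<^sub>R w) < d" "norm (a *\<^sub>R v + b *\<^sub>R w) < r"
        using tK by linarith+
    qed
    define g where "g s = f (x + s *\<^sub>R v + t *\<^sub>R w) - f (x + s *\<^sub>R v)" for s
    have line: "((\<lambda>s. f (x + s *\<^sub>R v + b *\<^sub>R w)) has_real_derivative ddir f (x + s *\<^sub>R v + b *\<^sub>R w) v) (at s)"
      if "0 \<le> s" "s \<le> t" "0 \<le> b" "b \<le> t" for s b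
    proof -
      have "x + s *\<^sub>R v + b *\<^sub>R w \<in> S"
        using r(2) small(2)[OF that] by (auto simp: dist_norm norm_minus_commute add.assoc subset_iff)
      from differentiable_has_ddir[OF assms(3)[OF this]] linear_ddir[OF assms(3)[OF this]]
      have 1: "(f has_derivative ddir f (x + s *\<^sub>R v + b *\<^sub>R w)) (at (x + s *\<^sub>R v + b *\<^sub>R w))"
        and 2: "linear (ddir f (x + s *\<^sub>R v + b *\<^sub>R w))" by auto
      have "((\<lambda>s. x + s *\<^sub>R v + b *\<^sub>R w) has_derivative (\<lambda>h. h *\<^sub>R v)) (at s)"
        by (auto intro!: derivative_eq_intros)
      from diff_chain_at[OF this 1] show ?thesis
        by (simp add: has_field_derivative_def o_def linear_scale[OF 2] mult_commute_abs)
    qed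
    have "\<exists>z. 0 < z \<and> z < t \<and> g t - g 0
        = (t - 0) * (ddir f (x + z *\<^sub>R v + t *\<^sub>R w) v - ddir f (x + z *\<^sub>R v) v)"
    proof (rule MVT2)
      fix s assume "0 \<le> s" "s \<le> t"
      then show "(g has_real_derivative ddir f (x + s *\<^sub>R v + t *\<^sub>R w) v - ddir f (x + s *\<^sub>R v) v) (at s)"
        unfolding g_def using line[of s t] line[of s 0] t by (auto intro!: derivative_intros)
    qed (use t in auto)
    then obtain z where z: "0 < z" "z < t"
      "g t - g 0 = t * (ddir f (x + z *\<^sub>R v + t *\<^sub>R w) v - ddir f (x + z *\<^sub>R v) v)" by auto
    let ?a = "ddir f (x + z *\<^sub>R v + t *\<^sub>R w) v" and ?b = "ddir f (x + z *\<^sub>R v) v"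
    have n1: "norm (z *\<^sub>R v + t *\<^sub>R w) < d" "norm (z *\<^sub>R v + t *\<^sub>R w) \<le> t * K"
      using small[of z t] z t by auto
    have n2: "norm (z *\<^sub>R v) < d" "norm (z *\<^sub>R v) \<le> t * K"
      using small[of z 0] z t by auto
    have "\<bar>?a - ddir f x v - P' (z *\<^sub>R v + t *\<^sub>R w)\<bar> \<le> e' * norm (z *\<^sub>R v + t *\<^sub>R w)"
      using d(2)[of "x + z *\<^sub>R v + t *\<^sub>R w"] n1 by (simp add: add.assoc)
    also have "\<dots> \<le> e' * (t * K)"
      using n1 e' by simp
    finally have 1: "\<bar>?a - ddir f x v - P' (z *\<^sub>R v + t *\<^sub>R w)\<bar> \<le> e' * (t * K)" .
    have "\<bar>?b - ddir f x v - P' (z *\<^sub>R v)\<bar> \<le> e' * norm (z *\<^sub>R v)"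
      using d(2)[of "x + z *\<^sub>R v"] n2 by simp
    also have "\<dots> \<le> e' * (t * K)"
      using n2 e' by simp
    finally have 2: "\<bar>?b - ddir f x v - P' (z *\<^sub>R v)\<bar> \<le> e' * (t * K)" .
    have "P' (z *\<^sub>R v + t *\<^sub>R w) = P' (z *\<^sub>R v) + t * P' w"
      by (simp add: linear_add[OF lin] linear_scale[OF lin])
    then have "\<bar>(?a - ?b) - t * P' w\<bar> \<le> 2 * (e' * (t * K))"
      using 1 2 by linarith
    then have "\<bar>(?a - ?b) - t * P' w\<bar> / t \<le> 2 * (e' * K)"
      using t by (simp add: field_simps)
    moreover have "?q t - P' w = ((?a - ?b) - t * P' w) / t"
    proof -
      have "f (x + t *\<^sub>R v + t *\<^sub>R w) - f (x + t *\<^sub>R v) - f (x + t *\<^sub>R w) + f x = t * (?a - ?b)"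
        using z(3) by (simp add: g_def)
      then have "?q t = (?a - ?b) / t"
        using t by (simp add: power2_eq_square)
      then show ?thesis
        using t by (simp add: field_simps)
    qed
    moreover have "2 * (e' * K) < e"
      using K \<open>e > 0\<close> by (simp add: e'_def)
    ultimately show ?thesis
      using t by (simp add: dist_real_def abs_divide)
  qed
  moreover have "eventually (\<lambda>t. 0 < t \<and> t < min d r / K) (at_right (0::real))"
    using eventually_at_right_real[of 0 "min d r / K"] d r K by simp
  ultimately show "eventually (\<lambda>t. dist (?q t) (P' w) < e) (at_right 0)"
    by (auto elim: eventually_mono)
qed

text \<open>The second difference quotient is symmetric in \<open>v\<close> and \<open>w\<close>,
  and its limit is unique.\<close>

lemma second_derivative_symmetric_real:
  fixes f :: "'a::real_normed_vector \<Rightarrow> real"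
  assumes "open S" "x \<in> S" "\<And>y. y \<in> S \<Longrightarrow> f differentiable (at y)"
    and "\<And>v. (\<lambda>y. ddir f y v) differentiable (at x)"
  shows "ddir (\<lambda>y. ddir f y v) x w = ddir (\<lambda>y. ddir f y w) x v"
proof -
  note L = second_difference_tendsto[OF assms(1-3) differentiable_has_ddir[OF assms(4)]]
  have "(\<lambda>t. (f (x + t *\<^sub>R w + t *\<^sub>R v) - f (x + t *\<^sub>R w) - f (x + t *\<^sub>R v) + f x) / t\<^sup>2)
      = (\<lambda>t. (f (x + t *\<^sub>R v + t *\<^sub>R w) - f (x + t *\<^sub>R v) - f (x + t *\<^sub>R w) + f x) / t\<^sup>2)"
    by (simp add: algebra_simps)
  then show ?thesis
    using tendsto_unique[OF _ L[of v w]] L[of w v] by simp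
qed

lemma second_derivative_symmetric:
  fixes f :: "'a::real_normed_vector \<Rightarrow> 'b::euclidean_space"
  assumes "open S" "x \<in> S" "\<And>y. y \<in> S \<Longrightarrow> f differentiable (at y)"
    and "\<And>y v. y \<in> S \<Longrightarrow> (\<lambda>y. ddir f y v) differentiable (at y)"
  shows "ddir (\<lambda>y. ddir f y v) x w = ddir (\<lambda>y. ddir f y w) x v"
proof (rule euclidean_eqI)
  fix i :: 'b
  have dinner: "(\<lambda>y. h y \<bullet> i) differentiable (at y) \<and> ddir (\<lambda>y. h y \<bullet> i) y v = ddir h y v \<bullet> i"
    if "h differentiable (at y)" for h :: "'a \<Rightarrow> 'b" and y v
    using has_derivative_inner_left[OF differentiable_has_ddir[OF that], of i] ddir_eq differentiableI
    by blast
  have d2: "ddir (\<lambda>y. ddir (\<lambda>y. f y \<bullet> i) y v) z w = ddir (\<lambda>y. ddir f y v) z w \<bullet> i" if "z \<in> S" for v w z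
  proof -
    have "ddir (\<lambda>y. ddir (\<lambda>y. f y \<bullet> i) y v) z w = ddir (\<lambda>y. ddir f y v \<bullet> i) z w"
      by (rule ddir_cong_open[OF assms(1) that]) (use dinner assms(3) in blast)
    then show ?thesis
      using dinner[OF assms(4)[OF that]] by simp
  qed
  have "ddir (\<lambda>y. ddir (\<lambda>y. f y \<bullet> i) y v) x w = ddir (\<lambda>y. ddir (\<lambda>y. f y \<bullet> i) y w) x v"
  proof (rule second_derivative_symmetric_real[OF assms(1,2)])
    show "(\<lambda>y. f y \<bullet> i) differentiable at y" if "y \<in> S" for y
      using dinner assms(3) that by blast
    show "(\<lambda>y. ddir (\<lambda>y. f y \<bullet> i) y v) differentiable (at x)" for v
      by (rule differentiable_cong_open[OF assms(1,2), of _ "\<lambda>y. ddir f y v \<bullet> i"])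
         (use dinner assms in blast)+
  qed
  then show "ddir (\<lambda>y. ddir f y v) x w \<bullet> i = ddir (\<lambda>y. ddir f y w) x v \<bullet> i"
    using d2 assms(2) by simp
qed

section \<open>Dependence of Riesz representatives on parameters\<close>

text \<open>The first factor is O(|y - u|) and the second o(1), so the product is o(|y - u|). This
  absorbs the error term in \<open>riesz_differentiable\<close>, where the second factor is so far
  only known to be continuous.\<close>

lemma has_derivative_mult_vanishing:
  fixes \<alpha> \<gamma> :: "'a::real_normed_vector \<Rightarrow> real"
  assumes "\<alpha> differentiable (at u)" "\<alpha> u = 0" "isCont \<gamma> u" "\<gamma> u = 0"
  shows "((\<lambda>w. \<alpha> w * \<gamma> w) has_derivative (\<lambda>_. 0)) (at u)"
  unfolding has_derivative_at_alt
proof (intro conjI allI impI)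
  fix e :: real assume "e > 0"
  have d: "(\<alpha> has_derivative ddir \<alpha> u) (at u)"
    using assms(1) by (rule differentiable_has_ddir)
  obtain B where B: "B > 0" "\<And>h. norm (ddir \<alpha> u h) \<le> norm h * B"
    using bounded_linear.pos_bounded[OF has_derivative_bounded_linear[OF d]] by blast
  obtain d1 where d1: "d1 > 0" "\<And>y. norm (y - u) < d1 \<Longrightarrow>
      norm (\<alpha> y - \<alpha> u - ddir \<alpha> u (y - u)) \<le> 1 * norm (y - u)"
    using d unfolding has_derivative_at_alt by (metis zero_less_one)
  obtain d2 where d2: "d2 > 0" "\<And>y. dist y u < d2 \<Longrightarrow> dist (\<gamma> y) (\<gamma> u) < e / (B + 1)"
    using assms(3) \<open>e > 0\<close> B(1) unfolding continuous_at_eps_delta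
    by (metis add_pos_pos divide_pos_pos zero_less_one)
  have "norm (\<alpha> y * \<gamma> y - \<alpha> u * \<gamma> u - 0) \<le> e * norm (y - u)" if "norm (y - u) < min d1 d2" for y
  proof -
    have "norm (\<alpha> y) \<le> norm (y - u) * (B + 1)"
      using d1(2)[of y] B(2)[of "y - u"] that assms(2) by (simp add: algebra_simps)
    moreover have "norm (\<gamma> y) \<le> e / (B + 1)"
      using d2(2)[of y] that assms(4) by (simp add: dist_norm)
    ultimately have "norm (\<alpha> y) * norm (\<gamma> y) \<le> (norm (y - u) * (B + 1)) * (e / (B + 1))"
      using B(1) by (intro mult_mono) auto
    then show ?thesis
      using B(1) assms(2) by (simp add: abs_mult mult.commute)
  qed
  then show "\<exists>d>0. \<forall>y. norm (y - u) < d \<longrightarrow> norm (\<alpha> y * \<gamma> y - \<alpha> u * \<gamma> u - 0) \<le> e * norm (y - u)"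
    using d1(1) d2(1) by (intro exI[of _ "min d1 d2"]) auto
qed (rule bounded_linear_zero)

text \<open>The entrywise deviation \<open>s w\<close> of the form at \<open>w\<close> from the form
  at \<open>u\<close> tends to 0, so near \<open>u\<close> the coercivity constant m survives as
  m/2. Testing the equation for \<open>D w\<close> against \<open>D w\<close> itself gives m/2 |D|^2
  <= |D| psi, and psi tends to 0 because \<open>W u\<close> solves the equation at
  \<open>u\<close>.\<close>

lemma riesz_continuous:
  fixes b :: "'a::real_normed_vector \<Rightarrow> 'b::euclidean_space \<Rightarrow> 'b \<Rightarrow> real"
  assumes "open S" "u \<in> S" "\<And>w. w \<in> S \<Longrightarrow> inner_form (b w)"
    and b: "\<And>x y. isCont (\<lambda>w. b w x y) u"
    and \<phi>: "\<And>z. isCont (\<lambda>w. \<phi> w z) u"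
    and W: "\<And>w z. w \<in> S \<Longrightarrow> b w (W w) z = \<phi> w z"
  shows "isCont W u"
proof -
  interpret u: inner_form "b u" by (rule assms(3)[OF assms(2)])
  obtain m where m: "m > 0" "\<And>x. b u x x \<ge> m * (norm x)\<^sup>2"
    using u.coercive by blast
  define s where "s w = (\<Sum>i\<in>Basis. \<Sum>j\<in>Basis. \<bar>b w i j - b u i j\<bar>)" for w
  define D where "D w = W w - W u" for w
  define \<psi> where "\<psi> w = (\<Sum>j\<in>Basis. \<bar>\<phi> w j - b w (W u) j\<bar>)" for w
  have "isCont s u"
    unfolding s_def by (intro continuous_intros b)
  then have "(s \<longlongrightarrow> 0) (at u)"
    unfolding continuous_at by (simp add: s_def)
  then have s: "eventually (\<lambda>w. s w < m / 2) (at u)"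
    using order_tendstoD(2)[of s 0 "at u" "m / 2"] m(1) by simp
  have "isCont \<psi> u"
    unfolding \<psi>_def by (intro continuous_intros b \<phi>)
  then have "((\<lambda>w. 2 / m * \<psi> w) \<longlongrightarrow> 2 / m * \<psi> u) (at u)"
    unfolding continuous_at by (intro tendsto_intros)
  moreover have "\<psi> u = 0"
    using W[OF assms(2)] by (simp add: \<psi>_def)
  ultimately have \<psi>: "((\<lambda>w. 2 / m * \<psi> w) \<longlongrightarrow> 0) (at u)"
    by simp
  have "norm (D w) \<le> 2 / m * \<psi> w" if "w \<in> S" "s w < m / 2" for w
  proof -
    interpret w: inner_form "b w" by (rule assms(3)[OF that(1)])
    have "\<bar>b w x x - b u x x\<bar> \<le> (norm x)\<^sup>2 * s w" for x
    proof -
      have "b w x x - b u x x = (\<Sum>i\<in>Basis. \<Sum>j\<in>Basis. ((x \<bullet> i) * (x \<bullet> j)) * (b w i j - b u i j))"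
        by (simp add: bilinear_expansion[OF w.bilinear_form, of x x]
            bilinear_expansion[OF u.bilinear_form, of x x] right_diff_distrib sum_subtractf)
      also have "\<bar>\<dots>\<bar> \<le> (\<Sum>i\<in>Basis. \<Sum>j\<in>Basis. \<bar>((x \<bullet> i) * (x \<bullet> j)) * (b w i j - b u i j)\<bar>)"
        by (intro order.trans[OF sum_abs] sum_mono order.trans[OF sum_abs]) auto
      also have "\<dots> \<le> (\<Sum>i\<in>Basis. \<Sum>j\<in>Basis. (norm x)\<^sup>2 * \<bar>b w i j - b u i j\<bar>)"
        unfolding abs_mult power2_eq_square
        by (intro sum_mono mult_right_mono mult_mono) (auto simp: Basis_le_norm)
      finally show ?thesis
        by (simp add: s_def sum_distrib_left)
    qed
    from this[of "D w"] have "b w (D w) (D w) \<ge> b u (D w) (D w) - (norm (D w))\<^sup>2 * s w"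
      by linarith
    moreover have "(norm (D w))\<^sup>2 * s w \<le> (norm (D w))\<^sup>2 * (m / 2)"
      using that(2) by (intro mult_left_mono) auto
    moreover have "b u (D w) (D w) \<ge> m * (norm (D w))\<^sup>2"
      by (rule m(2))
    ultimately have "m / 2 * (norm (D w))\<^sup>2 \<le> b w (D w) (D w)"
      by (simp add: algebra_simps)
    also have "b w (D w) (D w) = (\<Sum>j\<in>Basis. (D w \<bullet> j) * (\<phi> w j - b w (W u) j))"
    proof -
      have "b w (D w) (D w) = b w (D w) (\<Sum>j\<in>Basis. (D w \<bullet> j) *\<^sub>R j)"
        by (simp add: euclidean_representation)
      also have "\<dots> = (\<Sum>j\<in>Basis. (D w \<bullet> j) * b w (D w) j)"
        by (simp add: w.form_sum_right w.form_simps)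
      finally show ?thesis
        by (simp add: D_def w.form_simps W[OF that(1)])
    qed
    also have "\<dots> \<le> (\<Sum>j\<in>Basis. norm (D w) * \<bar>\<phi> w j - b w (W u) j\<bar>)"
    proof (intro sum_mono)
      fix j :: 'b assume "j \<in> Basis"
      then have "\<bar>D w \<bullet> j\<bar> * \<bar>\<phi> w j - b w (W u) j\<bar> \<le> norm (D w) * \<bar>\<phi> w j - b w (W u) j\<bar>"
        by (intro mult_right_mono) (auto simp: Basis_le_norm)
      then show "(D w \<bullet> j) * (\<phi> w j - b w (W u) j) \<le> norm (D w) * \<bar>\<phi> w j - b w (W u) j\<bar>"
        unfolding abs_mult[symmetric] by linarith
    qed
    finally have *: "m / 2 * (norm (D w))\<^sup>2 \<le> norm (D w) * \<psi> w"
      by (simp add: \<psi>_def sum_distrib_left)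
    have "\<psi> w \<ge> 0"
      by (simp add: \<psi>_def sum_nonneg)
    show ?thesis
    proof (cases "D w = 0")
      case True
      then show ?thesis using \<open>\<psi> w \<ge> 0\<close> m(1) by simp
    next
      case False
      then have "norm (D w) > 0" by simp
      moreover have "norm (D w) * (m / 2 * norm (D w)) \<le> norm (D w) * \<psi> w"
        using * by (simp add: power2_eq_square algebra_simps)
      ultimately have "m / 2 * norm (D w) \<le> \<psi> w"
        by (simp add: mult_le_cancel_left)
      then show ?thesis
        using m(1) by (simp add: field_simps)
    qed
  qed
  moreover have "eventually (\<lambda>w. w \<in> S) (at u)"
    using assms(1,2) by (rule eventually_at_in_open')
  ultimately have "eventually (\<lambda>w. norm (D w) \<le> 2 / m * \<psi> w) (at u)"
    using s by (auto elim: eventually_elim2)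
  then have "(D \<longlongrightarrow> 0) (at u)"
    using \<psi> by (rule Lim_null_comparison)
  then show ?thesis
    unfolding continuous_at D_def by (rule LIM_zero_cancel)
qed

text \<open>Writing \<open>W w = W u + \<Sum>\<^sub>i b\<^sub>u(W w - W u, e\<^sub>i) e\<^sub>i\<close> in a \<open>b\<^sub>u\<close>-orthonormal basis, each coefficient is
  \<open>\<phi>\<^sub>w(e\<^sub>i) - b\<^sub>w(W u, e\<^sub>i)\<close> up to \<open>(b\<^sub>w - b\<^sub>u)(W w - W u, e\<^sub>i)\<close>, which has derivative \<open>0\<close> because \<open>W\<close> is
  continuous.\<close>

lemma riesz_differentiable:
  fixes b :: "'a::real_normed_vector \<Rightarrow> 'b::euclidean_space \<Rightarrow> 'b \<Rightarrow> real"
  assumes "open S" "u \<in> S" "\<And>w. w \<in> S \<Longrightarrow> inner_form (b w)"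
    and b: "\<And>x y. (\<lambda>w. b w x y) differentiable (at u)"
    and \<phi>: "\<And>z. (\<lambda>w. \<phi> w z) differentiable (at u)"
    and W: "\<And>w z. w \<in> S \<Longrightarrow> b w (W w) z = \<phi> w z"
  shows "W differentiable (at u)"
proof -
  interpret u: inner_form "b u" by (rule assms(3)[OF assms(2)])
  obtain e where e: "u.orthonormal {1..DIM('b)} e" "span (e ` {1..DIM('b)}) = UNIV"
    by (rule u.orthonormal_exists[of "{1..DIM('b)}" UNIV]) auto
  have cont: "isCont W u"
    by (rule riesz_continuous[OF assms(1-3) _ _ W])
       (use b \<phi> in \<open>auto intro: differentiable_imp_continuous_within\<close>)
  define D where "D w = W w - W u" for w
  \<comment> \<open>Written in coordinates so that each summand is a differentiable coefficient
    times a continuous one, both vanishing at \<open>u\<close>.\<close>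
  define \<rho> where "\<rho> z w = (\<Sum>j\<in>Basis. (b w j z - b u j z) * (D w \<bullet> j))" for z w
  have "isCont (\<lambda>w. D w \<bullet> j) u" for j
    unfolding D_def by (intro continuous_intros cont)
  then have \<rho>: "\<rho> z differentiable (at u)" for z
    unfolding \<rho>_def
    by (intro differentiable_sum finite_Basis ballI differentiableI[OF has_derivative_mult_vanishing])
       (auto intro!: derivative_intros b simp: D_def)
  have "W w = W u + (\<Sum>i = 1..DIM('b). (\<phi> w (e i) - b w (W u) (e i) - \<rho> (e i) w) *\<^sub>R e i)" if "w \<in> S" for w
  proof -
    interpret w: inner_form "b w" by (rule assms(3)[OF that])
    have "D w = (\<Sum>i = 1..DIM('b). b u (D w) (e i) *\<^sub>R e i)"
      using u.orthonormal_expansion[OF e(1), of "D w"] e(2) by simp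
    moreover have "b u (D w) z = \<phi> w z - b w (W u) z - \<rho> z w" for z
    proof -
      have "b v (D w) z = (\<Sum>j\<in>Basis. b v j z * (D w \<bullet> j))" if "inner_form (b v)" for v
      proof -
        interpret v: inner_form "b v" by (rule that)
        have "b v (D w) z = b v (\<Sum>j\<in>Basis. (D w \<bullet> j) *\<^sub>R j) z"
          by (simp add: euclidean_representation)
        then show ?thesis
          by (simp add: v.form_sum_left v.form_simps mult.commute)
      qed
      then have "\<rho> z w = b w (D w) z - b u (D w) z"
        using w.inner_form_axioms u.inner_form_axioms
        by (simp add: \<rho>_def left_diff_distrib sum_subtractf)
      then show ?thesis
        by (simp add: D_def w.form_simps W[OF that])
    qed
    ultimately have "D w = (\<Sum>i = 1..DIM('b). (\<phi> w (e i) - b w (W u) (e i) - \<rho> (e i) w) *\<^sub>R e i)"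
      by simp
    then show ?thesis
      by (simp only: D_def diff_eq_eq add.commute)
  qed
  moreover have "(\<lambda>w. W u + (\<Sum>i = 1..DIM('b). (\<phi> w (e i) - b w (W u) (e i) - \<rho> (e i) w) *\<^sub>R e i))
      differentiable (at u)"
    by (intro derivative_intros \<rho> \<phi> b differentiable_sum ballI) auto
  ultimately show ?thesis
    by (rule differentiable_cong_open[OF assms(1,2)])
qed

section \<open>The Levi-Civita connection along a map\<close>

text \<open>Second order differentiability, in the form below, is all that is used of a smooth metric.
  It passes to the metric induced by an immersion by means of the product rule alone.\<close>

locale metric_patch =
  fixes V :: "'f::euclidean_space set" and G :: "'f metric"
  assumes open_patch: "open V"
    and inner_form_metric: "y \<in> V \<Longrightarrow> inner_form (G y)"
    and metric_differentiable: "y \<in> V \<Longrightarrow> (\<lambda>q. G q X Y) differentiable (at y)"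
    and metric_differentiable2: "y \<in> V \<Longrightarrow> (\<lambda>q. ddir (\<lambda>q. G q X Y) q Z) differentiable (at y)"
begin

lemma bilinear_metric: "y \<in> V \<Longrightarrow> bilinear (G y)"
  using inner_form_metric inner_form.bilinear_form by blast

lemma metric_commute: "y \<in> V \<Longrightarrow> G y a b = G y b a"
  using inner_form_metric inner_form.form_commute by blast

lemma metric_eqI: "y \<in> V \<Longrightarrow> (\<And>z. G y a z = G y b z) \<Longrightarrow> a = b"
  using inner_form_metric inner_form.form_eqI by blast

lemmas metric_simps =
  bilinear_ladd[OF bilinear_metric] bilinear_radd[OF bilinear_metric]
  bilinear_lmul[OF bilinear_metric] bilinear_rmul[OF bilinear_metric]
  bilinear_lsub[OF bilinear_metric] bilinear_rsub[OF bilinear_metric]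
  bilinear_lzero[OF bilinear_metric] bilinear_rzero[OF bilinear_metric]
  bilinear_lneg[OF bilinear_metric] bilinear_rneg[OF bilinear_metric]

lemma ddir_metric_commute:
  assumes "y \<in> V"
  shows "ddir (\<lambda>q. G q a b) y X = ddir (\<lambda>q. G q b a) y X"
  by (rule ddir_cong_open[OF open_patch assms metric_commute])

lemma linear_ddir_metric:
  assumes "y \<in> V"
  shows "linear (ddir (\<lambda>q. G q a b) y)" "linear (\<lambda>b. ddir (\<lambda>q. G q a b) y X)"
    "linear (\<lambda>a. ddir (\<lambda>q. G q a b) y X)"
proof -
  note d = differentiable_has_ddir[OF metric_differentiable[OF assms]]
  show "linear (ddir (\<lambda>q. G q a b) y)"
    by (rule linear_ddir[OF metric_differentiable[OF assms]])
  show *: "linear (\<lambda>b. ddir (\<lambda>q. G q a b) y X)" for a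
  proof (rule linearI)
    fix b b' and r :: real
    have "ddir (\<lambda>q. G q a (b + b')) y X = ddir (\<lambda>q. G q a b + G q a b') y X"
      by (rule ddir_cong_open[OF open_patch assms]) (simp add: metric_simps)
    then show "ddir (\<lambda>q. G q a (b + b')) y X = ddir (\<lambda>q. G q a b) y X + ddir (\<lambda>q. G q a b') y X"
      using ddir_eq[OF has_derivative_add[OF d d]] by simp
    have "ddir (\<lambda>q. G q a (r *\<^sub>R b)) y X = ddir (\<lambda>q. r *\<^sub>R G q a b) y X"
      by (rule ddir_cong_open[OF open_patch assms]) (simp add: metric_simps)
    then show "ddir (\<lambda>q. G q a (r *\<^sub>R b)) y X = r *\<^sub>R ddir (\<lambda>q. G q a b) y X"
      using ddir_eq[OF has_derivative_scaleR_right[OF d]] by metis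
  qed
  show "linear (\<lambda>a. ddir (\<lambda>q. G q a b) y X)"
    using *[of b] by (simp add: ddir_metric_commute[OF assms, of _ b])
qed

section \<open>Koszul formula and Christoffel symbols\<close>

definition koszul :: "'f \<Rightarrow> 'f \<Rightarrow> 'f \<Rightarrow> 'f \<Rightarrow> real" where
  "koszul y X Y Z =
    (ddir (\<lambda>q. G q Y Z) y X + ddir (\<lambda>q. G q X Z) y Y - ddir (\<lambda>q. G q X Y) y Z) / 2"

lemma linear_koszul:
  assumes "y \<in> V"
  shows "linear (koszul y X Y)" "linear (\<lambda>Y. koszul y X Y Z)"
  by (rule linearI; simp add: koszul_def linear_add[OF linear_ddir_metric(1)[OF assms]]
      linear_add[OF linear_ddir_metric(2)[OF assms]] linear_scale[OF linear_ddir_metric(1)[OF assms]]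
      linear_scale[OF linear_ddir_metric(2)[OF assms]] linear_add[OF linear_ddir_metric(3)[OF assms]]
      linear_scale[OF linear_ddir_metric(3)[OF assms]] field_simps)+

lemma koszul_commute: "y \<in> V \<Longrightarrow> koszul y X Y Z = koszul y Y X Z"
  using ddir_metric_commute[of y X Y Z] by (simp add: koszul_def)

lemma metric_christoffel:
  assumes "y \<in> V"
  shows "G y (christoffel G y X Y) Z = koszul y X Y Z"
proof -
  interpret inner_form "G y" by (rule inner_form_metric[OF assms])
  show ?thesis
    using theI'[OF riesz[OF linear_koszul(1)[OF assms, of X Y]]]
    by (simp add: christoffel_def koszul_def)
qed

lemma christoffel_eqI:
  assumes "y \<in> V" "\<And>Z. G y W Z = koszul y X Y Z"
  shows "christoffel G y X Y = W"
  by (rule metric_eqI[OF assms(1)]) (simp add: assms metric_christoffel)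

lemma christoffel_commute: "y \<in> V \<Longrightarrow> christoffel G y X Y = christoffel G y Y X"
  by (rule christoffel_eqI) (simp_all add: metric_christoffel koszul_commute)

lemma bilinear_christoffel:
  assumes "y \<in> V"
  shows "bilinear (christoffel G y)"
proof -
  have "linear (christoffel G y X)" for X
    by (rule linearI; rule metric_eqI[OF assms];
        simp add: metric_christoffel assms metric_simps linear_add[OF linear_koszul(2)]
          linear_scale[OF linear_koszul(2)])
  then show ?thesis
    by (auto simp: bilinear_def christoffel_commute[OF assms, of _ y] christoffel_commute[OF assms, of "_ :: 'f" "_ :: 'f"])
qed

text \<open>Metric compatibility: when the two Koszul expressions are added, the derivatives along
  \<open>a\<close> and \<open>b\<close> cancel and the one along \<open>X\<close> doubles.\<close>

lemma ddir_metric: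
  assumes "y \<in> V"
  shows "ddir (\<lambda>q. G q a b) y X = G y (christoffel G y X a) b + G y a (christoffel G y X b)"
  by (simp add: metric_commute[OF assms, of a] metric_christoffel[OF assms] koszul_def
      ddir_metric_commute[OF assms, of b a] field_simps)

lemma christoffel_differentiable:
  assumes "y \<in> V"
  shows "(\<lambda>q. christoffel G q X Y) differentiable (at y)"
proof (rule riesz_differentiable[OF open_patch assms inner_form_metric])
  show "(\<lambda>q. G q a b) differentiable at y" for a b
    by (rule metric_differentiable[OF assms])
  show "(\<lambda>q. koszul q X Y Z) differentiable at y" for Z
    unfolding koszul_def divide_inverse
    by (intro derivative_intros metric_differentiable2[OF assms])
qed (auto intro: metric_christoffel)

lemma cov_deriv_has_derivative_metric:
  fixes f :: "'e::euclidean_space \<Rightarrow> 'f"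
  assumes "f u \<in> V" "f differentiable (at u)" "A differentiable (at u)" "B differentiable (at u)"
  shows "((\<lambda>w. G (f w) (A w) (B w)) has_derivative
    (\<lambda>X. G (f u) (cov_deriv G f X A u) (B u) + G (f u) (A u) (cov_deriv G f X B u))) (at u)"
proof -
  have "(\<lambda>X. ddir (\<lambda>y. G y (A u) (B u)) (f u) (ddir f u X) + G (f u) (ddir A u X) (B u) + G (f u) (A u) (ddir B u X))
    = (\<lambda>X. G (f u) (cov_deriv G f X A u) (B u) + G (f u) (A u) (cov_deriv G f X B u))"
    by (rule ext) (simp add: ddir_metric[OF assms(1)] cov_deriv_def metric_simps[OF assms(1)])
  then show ?thesis
    using has_derivative_bilinear_field[of V f u G, OF open_patch assms(1) bilinear_metric
        metric_differentiable[OF assms(1)] assms(2-4)[THEN differentiable_has_ddir]]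
    by simp
qed

lemmas ddir_metric_field = ddir_eq[OF cov_deriv_has_derivative_metric]
lemmas metric_field_differentiable = differentiableI[OF cov_deriv_has_derivative_metric]

lemma christoffel_field_has_derivative:
  fixes f :: "'e::euclidean_space \<Rightarrow> 'f"
  assumes "f u \<in> V" "f differentiable (at u)" "A differentiable (at u)" "B differentiable (at u)"
  shows "((\<lambda>w. christoffel G (f w) (A w) (B w)) has_derivative
    (\<lambda>X. ddir (\<lambda>q. christoffel G q (A u) (B u)) (f u) (ddir f u X)
       + christoffel G (f u) (ddir A u X) (B u) + christoffel G (f u) (A u) (ddir B u X))) (at u)"
  by (rule has_derivative_bilinear_field[of V f u, OF open_patch assms(1) bilinear_christoffel
        christoffel_differentiable[OF assms(1)] assms(2-4)[THEN differentiable_has_ddir]])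

lemma cov_deriv_has_derivative:
  fixes f :: "'e::euclidean_space \<Rightarrow> 'f"
  assumes "f u \<in> V" "f differentiable (at u)" "A differentiable (at u)"
    and "(\<lambda>w. ddir f w X) differentiable (at u)" "(\<lambda>w. ddir A w X) differentiable (at u)"
  shows "(cov_deriv G f X A has_derivative
    (\<lambda>Y. ddir (\<lambda>w. ddir A w X) u Y + (ddir (\<lambda>q. christoffel G q (ddir f u X) (A u)) (f u) (ddir f u Y)
       + christoffel G (f u) (ddir (\<lambda>w. ddir f w X) u Y) (A u)
       + christoffel G (f u) (ddir f u X) (ddir A u Y)))) (at u)"
  unfolding cov_deriv_def
  by (intro has_derivative_add differentiable_has_ddir assms christoffel_field_has_derivative)

lemmas cov_deriv_differentiable = differentiableI[OF cov_deriv_has_derivative]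

lemma cov_deriv_diff:
  fixes f :: "'e::euclidean_space \<Rightarrow> 'f"
  assumes "f u \<in> V" "A differentiable (at u)" "B differentiable (at u)"
  shows "cov_deriv G f X (\<lambda>w. A w - B w) u = cov_deriv G f X A u - cov_deriv G f X B u"
  using ddir_eq[OF has_derivative_diff[OF assms(2,3)[THEN differentiable_has_ddir]], of X]
  by (simp add: cov_deriv_def bilinear_rsub[OF bilinear_christoffel[OF assms(1)]])

lemma cov_deriv_cong_open:
  assumes "open S" "u \<in> S" "\<And>w. w \<in> S \<Longrightarrow> A w = B w"
  shows "cov_deriv G f X A u = cov_deriv G f X B u"
  using ddir_cong_open[OF assms] assms(2,3) by (simp add: cov_deriv_def)

lemma cov_deriv_torsion_free:
  fixes f :: "'e::euclidean_space \<Rightarrow> 'f"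
  assumes "f u \<in> V" "open U" "u \<in> U" "\<And>w. w \<in> U \<Longrightarrow> f differentiable (at w)"
    and "\<And>w v. w \<in> U \<Longrightarrow> (\<lambda>w. ddir f w v) differentiable (at w)"
  shows "cov_deriv G f X (\<lambda>w. ddir f w Y) u = cov_deriv G f Y (\<lambda>w. ddir f w X) u"
  using second_derivative_symmetric[OF assms(2-5), of X Y] christoffel_commute[OF assms(1)]
  by (simp add: cov_deriv_def)

section \<open>Curvature\<close>

lemma curvature_eq:
  "curvature G y X Y Z =
    ddir (\<lambda>q. christoffel G q Y Z) y X + christoffel G y X (christoffel G y Y Z)
    - (ddir (\<lambda>q. christoffel G q X Z) y Y + christoffel G y Y (christoffel G y X Z))"
proof -
  have "cov_deriv G id Y (\<lambda>_. Z) = (\<lambda>q. christoffel G q Y Z)" for Y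
    by (rule ext) (simp add: cov_deriv_def)
  then show ?thesis
    unfolding curvature_def by (simp add: cov_deriv_def)
qed

text \<open>Curvature of the pulled-back connection. In the commutator, second derivatives of
  \<open>f\<close> and \<open>A\<close> cancel by symmetry, and first derivatives of
  \<open>A\<close> enter symmetrically, so only the value \<open>A u\<close> is left. Tangent fields
  give the Gauss equation, normal fields the Ricci equation.\<close>

lemma cov_deriv_curvature:
  fixes f :: "'e::euclidean_space \<Rightarrow> 'f"
  assumes "f u \<in> V" "open U" "u \<in> U" "\<And>w. w \<in> U \<Longrightarrow> f differentiable (at w)"
    and f2: "\<And>w v. w \<in> U \<Longrightarrow> (\<lambda>w. ddir f w v) differentiable (at w)"
    and A: "\<And>w. w \<in> U \<Longrightarrow> A differentiable (at w)"
    and A2: "\<And>w v. w \<in> U \<Longrightarrow> (\<lambda>w. ddir A w v) differentiable (at w)"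
  shows "cov_deriv G f X (cov_deriv G f Y A) u - cov_deriv G f Y (cov_deriv G f X A) u
    = curvature G (f u) (ddir f u X) (ddir f u Y) (A u)"
proof -
  have d: "ddir (cov_deriv G f X A) u Y =
      ddir (\<lambda>w. ddir A w X) u Y + (ddir (\<lambda>q. christoffel G q (ddir f u X) (A u)) (f u) (ddir f u Y)
       + christoffel G (f u) (ddir (\<lambda>w. ddir f w X) u Y) (A u)
       + christoffel G (f u) (ddir f u X) (ddir A u Y))" for X Y
    by (intro ddir_eq cov_deriv_has_derivative assms)
  note s = second_derivative_symmetric[OF assms(2,3,4) f2, of X Y]
    second_derivative_symmetric[OF assms(2,3) A A2, of X Y]
  show ?thesis
    unfolding cov_deriv_def[of G f X "cov_deriv _ _ _ _"] cov_deriv_def[of G f Y "cov_deriv _ _ _ _"] d curvature_eq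
    by (simp add: s cov_deriv_def bilinear_radd[OF bilinear_christoffel[OF assms(1)]])
qed

lemma linear_curvature:
  assumes "y \<in> V"
  shows "linear (\<lambda>X. curvature G y X Y Z)" "linear (curvature G y X Y)"
proof -
  note d = differentiable_has_ddir[OF christoffel_differentiable[OF assms]]
  note b = bilinear_ladd[OF bilinear_christoffel] bilinear_radd[OF bilinear_christoffel]
    bilinear_lmul[OF bilinear_christoffel] bilinear_rmul[OF bilinear_christoffel]
  have add: "ddir (\<lambda>q. christoffel G q X (Z + Z')) y Y
      = ddir (\<lambda>q. christoffel G q X Z) y Y + ddir (\<lambda>q. christoffel G q X Z') y Y" for X Y Z Z'
  proof -
    have "ddir (\<lambda>q. christoffel G q X (Z + Z')) y Y
        = ddir (\<lambda>q. christoffel G q X Z + christoffel G q X Z') y Y"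
      by (rule ddir_cong_open[OF open_patch assms]) (simp add: b)
    then show ?thesis
      using ddir_eq[OF has_derivative_add[OF d d]] by simp
  qed
  have scale: "ddir (\<lambda>q. christoffel G q X (r *\<^sub>R Z)) y Y
      = r *\<^sub>R ddir (\<lambda>q. christoffel G q X Z) y Y" for X Y Z r
  proof -
    have "ddir (\<lambda>q. christoffel G q X (r *\<^sub>R Z)) y Y = ddir (\<lambda>q. r *\<^sub>R christoffel G q X Z) y Y"
      by (rule ddir_cong_open[OF open_patch assms]) (simp add: b)
    then show ?thesis
      using ddir_eq[OF has_derivative_scaleR_right[OF d]] by metis
  qed
  \<comment> \<open>\<open>add\<close> and \<open>scale\<close> concern the second argument of
    \<open>christoffel\<close>; symmetry carries them over to the first.\<close>
  have comm: "ddir (\<lambda>q. christoffel G q X Z) y Y = ddir (\<lambda>q. christoffel G q Z X) y Y" for X Y Z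
    by (rule ddir_cong_open[OF open_patch assms christoffel_commute])
  note lin = linear_ddir[OF christoffel_differentiable[OF assms]]
  show "linear (\<lambda>X. curvature G y X Y Z)"
    by (rule linearI; simp add: curvature_eq comm[of _ Z] add scale b[OF assms]
        linear_add[OF lin] linear_scale[OF lin] algebra_simps)
  show "linear (curvature G y X Y)"
    by (rule linearI; simp add: curvature_eq add scale b[OF assms] algebra_simps)
qed

lemma curvature_antisym: "curvature G y X Y Z = - curvature G y Y X Z"
  by (simp add: curvature_eq)

lemma bianchi:
  assumes "y \<in> V"
  shows "curvature G y X Y Z + curvature G y Y Z X + curvature G y Z X Y = 0"
proof -
  have comm: "ddir (\<lambda>q. christoffel G q X Z) y Y = ddir (\<lambda>q. christoffel G q Z X) y Y" for X Y Z
    by (rule ddir_cong_open[OF open_patch assms christoffel_commute])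
  show ?thesis
    by (simp add: curvature_eq comm[of X Y] comm[of Y Z] comm[of X Z] christoffel_commute[OF assms, of X Y]
        christoffel_commute[OF assms, of Y Z] christoffel_commute[OF assms, of X Z])
qed

text \<open>Differentiate the function \<open>G q Z W\<close> twice by metric compatibility. Its
  second derivatives commute, and the products of two first covariant derivatives are symmetric in
  \<open>X\<close> and \<open>Y\<close>, so only the curvature terms remain.\<close>

lemma curvature_metric_antisym:
  assumes "y \<in> V"
  shows "G y (curvature G y X Y Z) W = - G y (curvature G y X Y W) Z"
proof -
  define c where "c X Z = (\<lambda>q. christoffel G q X Z)" for X Z
  have cd: "c X Z differentiable (at q)" if "q \<in> V" for X Z q
    unfolding c_def by (rule christoffel_differentiable[OF that])
  have D: "ddir (\<lambda>q. ddir (\<lambda>q. G q Z W) q Y) y X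
    = G y (cov_deriv G id X (c Y Z) y) W + G y (c Y Z y) (c X W y)
      + (G y (c X Z y) (c Y W y) + G y Z (cov_deriv G id X (c Y W) y))" for X Y
  proof -
    have "ddir (\<lambda>q. ddir (\<lambda>q. G q Z W) q Y) y X = ddir (\<lambda>q. G (id q) (c Y Z q) W + G (id q) Z (c Y W q)) y X"
      by (rule ddir_cong_open[OF open_patch assms]) (simp add: ddir_metric c_def)
    also have "\<dots> = G (id y) (cov_deriv G id X (c Y Z) y) W + G (id y) (c Y Z y) (cov_deriv G id X (\<lambda>_. W) y)
      + (G (id y) (cov_deriv G id X (\<lambda>_. Z) y) (c Y W y) + G (id y) Z (cov_deriv G id X (c Y W) y))"
      by (intro ddir_eq has_derivative_add cov_deriv_has_derivative_metric cd)
         (use assms in \<open>auto simp: id_def\<close>)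
    finally show ?thesis
      by (simp add: c_def cov_deriv_def)
  qed
  have "ddir (\<lambda>q. ddir (\<lambda>q. G q Z W) q Y) y X = ddir (\<lambda>q. ddir (\<lambda>q. G q Z W) q X) y Y"
    by (rule second_derivative_symmetric[OF open_patch assms metric_differentiable metric_differentiable2])
  then have "G y (cov_deriv G id X (c Y Z) y - cov_deriv G id Y (c X Z) y) W
      + G y Z (cov_deriv G id X (c Y W) y - cov_deriv G id Y (c X W) y) = 0"
    unfolding D by (simp add: metric_simps[OF assms])
  moreover have "cov_deriv G id X (c Y Z) y - cov_deriv G id Y (c X Z) y = curvature G y X Y Z" for Z
    by (simp add: curvature_eq cov_deriv_def c_def)
  ultimately show ?thesis
    using metric_commute[OF assms, of Z] by simp
qed

end

section \<open>Algebraic curvature tensors\<close>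

text \<open>Pair symmetry makes T(X, Y, Y, X') symmetric in X and X', so polarising
  \<open>diag\<close> kills it. Polarising again in Y gives skew symmetry in the two middle
  arguments; then the three Bianchi terms are equal and 3 T = 0.\<close>

lemma curvature_like_tensor_eq_0:
  fixes T :: "'a::ab_group_add \<Rightarrow> 'a \<Rightarrow> 'a \<Rightarrow> 'a \<Rightarrow> real"
  assumes add1: "\<And>X X' Y Z W. T (X + X') Y Z W = T X Y Z W + T X' Y Z W"
    and add3: "\<And>X Y Z Z' W. T X Y (Z + Z') W = T X Y Z W + T X Y Z' W"
    and anti12: "\<And>X Y Z W. T X Y Z W = - T Y X Z W"
    and anti34: "\<And>X Y Z W. T X Y Z W = - T X Y W Z"
    and bianchi: "\<And>X Y Z W. T X Y Z W + T Y Z X W + T Z X Y W = 0"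
    and diag: "\<And>X Y. T X Y Y X = 0"
  shows "T X Y Z W = 0"
proof -
  \<comment> \<open>The classical octahedron argument: combine the Bianchi identities for the four
    cyclic shifts of the arguments with both skew symmetries.\<close>
  have pair: "T X Y Z W = T Z W X Y" for X Y Z W
    using bianchi[of X Y Z W] bianchi[of Y Z W X] bianchi[of Z W X Y] bianchi[of W X Y Z]
      anti12[of Y Z X W] anti34[of Y Z X W] anti12[of Z X Y W] anti34[of Z X Y W]
      anti12[of X Y Z W] anti34[of X Y Z W] anti12[of Z W X Y] anti34[of Z W X Y]
      anti12[of Y W X Z] anti34[of Y W X Z] anti12[of W X Y Z] anti34[of W X Y Z]
      anti12[of W Y Z X] anti34[of W Y Z X] anti34[of Z W Y X] anti34[of X Y W Z]
      anti12[of X W Y Z] anti12[of X Z W Y] anti12[of W Y X Z] anti12[of Y W Z X] anti34[of X Z W Y]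
      anti34[of Z X W Y] anti34[of W X Z Y] anti34[of Y Z W X] anti34[of W Y X Z]
    by linarith
  have add2: "T X (Y + Y') Z W = T X Y Z W + T X Y' Z W" for X Y Y' Z W
    using anti12[of X "Y + Y'" Z W] anti12[of X Y Z W] anti12[of X Y' Z W] add1[of Y Y' X Z W] by linarith
  have add4: "T X Y Z (W + W') = T X Y Z W + T X Y Z W'" for X Y Z W W'
    using anti34[of X Y Z "W + W'"] anti34[of X Y Z W] anti34[of X Y Z W'] add3[of X Y W W' Z] by linarith
  have zero: "T X Y Y X' = 0" for X X' Y
    using diag[of "X + X'" Y] diag[of X Y] diag[of X' Y] pair[of X' Y Y X]
      anti12[of Y X X' Y] anti34[of X Y X' Y] unfolding add1 add4 by linarith
  have anti23: "T X Y Z W = - T X Z Y W" for X Y Z W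
    using zero[of X "Y + Z" W] zero[of X Y W] zero[of X Z W] unfolding add2 add3 by linarith
  show ?thesis
    using bianchi[of X Y Z W] anti23[of X Y Z W] anti12[of X Z Y W] anti23[of Y Z X W] anti12[of Y X Z W]
      by linarith
qed

context metric_patch
begin

text \<open>The difference of the curvature tensor and the model tensor has all symmetries of a
  curvature tensor, so its values T(X, Y, Y, X) decide. Dependent pairs are handled separately,
  since the sectional curvature says nothing about them.\<close>

lemma constant_sectional_curvature:
  assumes y: "y \<in> V"
    and sec: "\<And>X Y. X \<noteq> Y \<Longrightarrow> independent {X, Y} \<Longrightarrow> sectional_curvature G y X Y = c"
  shows "G y (curvature G y X Y Z) W = c * (G y Y Z * G y X W - G y X Z * G y Y W)"
proof -
  interpret inner_form "G y" by (rule inner_form_metric[OF y])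
  define T where "T X Y Z W = G y (curvature G y X Y Z) W - c * (G y Y Z * G y X W - G y X Z * G y Y W)" for X Y Z W
  note lin = linear_curvature[OF y]
  have add: "T (X + X') Y Z W = T X Y Z W + T X' Y Z W" "T X Y (Z + Z') W = T X Y Z W + T X Y Z' W"
    for X X' Y Z Z' W
    unfolding T_def by (simp_all add: linear_add[OF lin(1)] linear_add[OF lin(2)] form_simps algebra_simps)
  have anti12: "T X Y Z W = - T Y X Z W" for X Y Z W
    unfolding T_def curvature_antisym[of y X Y] by (simp add: form_simps algebra_simps)
  have anti34: "T X Y Z W = - T X Y W Z" for X Y Z W
    unfolding T_def curvature_metric_antisym[OF y, of X Y Z W] by (simp add: algebra_simps)
  have bian: "T X Y Z W + T Y Z X W + T Z X Y W = 0" for X Y Z W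
    using arg_cong[OF bianchi[OF y, of X Y Z], of "\<lambda>v. G y v W"]
    unfolding T_def by (simp add: form_simps algebra_simps form_commute[of Z X] form_commute[of Z Y] form_commute[of Y X])
  have diag: "T X Y Y X = 0" for X Y
  proof (cases "Y = 0")
    case True
    then show ?thesis
      by (simp add: T_def linear_0[OF lin(2)] form_simps)
  next
    case False
    then have Y: "G y Y Y > 0" by (rule form_pos)
    \<comment> \<open>\<open>k *\<^sub>R Y\<close> is the projection of \<open>X\<close> to the line
      of \<open>Y\<close>; the squared length of the residual is the Gram determinant over
      \<open>G y Y Y\<close>, so the denominator of the sectional curvature is positive.\<close>
    define k where "k = G y X Y / G y Y Y"
    show ?thesis
    proof (cases "X = k *\<^sub>R Y")
      case True
      have "curvature G y Y Y Y = 0"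
        by (simp add: curvature_eq)
      then show ?thesis
        using True by (simp add: T_def linear_scale[OF lin(1)] form_simps)
    next
      case F: False
      have "X \<notin> span {Y}"
      proof
        assume "X \<in> span {Y}"
        then obtain r where "X = r *\<^sub>R Y"
          by (auto simp: span_singleton)
        then show False
          using F Y by (simp add: k_def form_simps)
      qed
      then have "X \<noteq> Y" "independent {X, Y}"
        using False by (auto simp: span_base independent_insert)
      from sec[OF this] have s: "sectional_curvature G y X Y = c" .
      have "0 < G y (X - k *\<^sub>R Y) (X - k *\<^sub>R Y)"
        using F by (intro form_pos) auto
      also have "\<dots> = (G y X X * G y Y Y - (G y X Y)\<^sup>2) / G y Y Y"
        using Y form_commute[of Y X] by (simp add: k_def form_simps field_simps power2_eq_square)
      finally have "G y X X * G y Y Y - (G y X Y)\<^sup>2 > 0"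
        using Y by (simp add: zero_less_divide_iff)
      then show ?thesis
        using s form_commute[of Y X]
        by (simp add: T_def sectional_curvature_def field_simps power2_eq_square)
    qed
  qed
  have "T X Y Z W = 0"
    by (rule curvature_like_tensor_eq_0[of T, OF add anti12 anti34 bian diag])
  then show ?thesis
    by (simp add: T_def)
qed

end

section \<open>Immersions: the equations of Gauss and Ricci\<close>

text \<open>The induced metric contains first derivatives of \<open>f\<close>, and a
  \<open>metric_patch\<close> has to be differentiable twice more; hence three orders for
  \<open>f\<close>.\<close>

locale immersed_patch = metric_patch V G
  for V :: "'f::euclidean_space set" and G :: "'f metric" +
  fixes U :: "'e::euclidean_space set" and f :: "'e \<Rightarrow> 'f"
  assumes open_domain: "open U"
    and maps: "w \<in> U \<Longrightarrow> f w \<in> V"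
    and differentiable1: "w \<in> U \<Longrightarrow> f differentiable (at w)"
    and differentiable2: "w \<in> U \<Longrightarrow> (\<lambda>w. ddir f w X) differentiable (at w)"
    and differentiable3: "w \<in> U \<Longrightarrow> (\<lambda>w. ddir (\<lambda>w. ddir f w X) w Y) differentiable (at w)"
    and inj_ddir: "w \<in> U \<Longrightarrow> inj (ddir f w)"
begin

abbreviation "g \<equiv> induced_metric G f"
abbreviation "hess X Y \<equiv> cov_deriv G f X (\<lambda>w. ddir f w Y)"
abbreviation "h \<equiv> second_fundamental_form G f"

lemma linear_ddir_f: "w \<in> U \<Longrightarrow> linear (ddir f w)"
  by (rule linear_ddir[OF differentiable1])

lemmas ddir_f_simps = linear_add[OF linear_ddir_f] linear_scale[OF linear_ddir_f]
  linear_diff[OF linear_ddir_f] linear_0[OF linear_ddir_f] linear_neg[OF linear_ddir_f]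

lemma inner_form_induced:
  assumes "w \<in> U"
  shows "inner_form (g w)"
proof
  interpret inner_form "G (f w)" by (rule inner_form_metric[OF maps[OF assms]])
  show "bilinear (g w)"
    unfolding bilinear_def induced_metric_def
    by (auto intro!: linearI simp: ddir_f_simps[OF assms] form_simps)
  show "g w x y = g w y x" for x y
    by (simp add: induced_metric_def form_commute)
  show "g w x x > 0" if "x \<noteq> 0" for x
    using inj_ddir[OF assms] linear_injective_0[OF linear_ddir_f[OF assms]] that
    by (auto simp: induced_metric_def intro!: form_pos)
qed

lemma hess_commute: "w \<in> U \<Longrightarrow> hess X Y w = hess Y X w"
  by (rule cov_deriv_torsion_free[OF maps open_domain _ differentiable1 differentiable2])

lemma hess_differentiable: "w \<in> U \<Longrightarrow> hess X Y differentiable (at w)"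
  by (intro cov_deriv_differentiable maps differentiable1 differentiable2 differentiable3)

lemma induced_has_derivative:
  assumes "w \<in> U"
  shows "((\<lambda>w. g w X Y) has_derivative
    (\<lambda>Z. G (f w) (hess Z X w) (ddir f w Y) + G (f w) (ddir f w X) (hess Z Y w))) (at w)"
  unfolding induced_metric_def
  by (intro cov_deriv_has_derivative_metric maps differentiable1 differentiable2 assms)

text \<open>Writing the derivative of the induced metric through \<open>hess\<close> presents it as
  a metric product of fields along \<open>f\<close>, so the same Leibniz rule gives the second
  order.\<close>

sublocale induced: metric_patch U g
proof (rule metric_patch.intro)
  show "open U" by (rule open_domain)
  fix w assume w: "w \<in> U"
  show "inner_form (g w)" by (rule inner_form_induced[OF w])
  show "(\<lambda>q. g q X Y) differentiable at w" for X Y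
    by (rule differentiableI[OF induced_has_derivative[OF w]])
  show "(\<lambda>q. ddir (\<lambda>q. g q X Y) q Z) differentiable at w" for X Y Z
  proof (rule differentiable_cong_open[OF open_domain w])
    show "ddir (\<lambda>q. g q X Y) q Z = G (f q) (hess Z X q) (ddir f q Y) + G (f q) (ddir f q X) (hess Z Y q)"
      if "q \<in> U" for q
      by (rule ddir_eq[OF induced_has_derivative[OF that]])
    show "(\<lambda>q. G (f q) (hess Z X q) (ddir f q Y) + G (f q) (ddir f q X) (hess Z Y q)) differentiable at w"
      by (intro differentiable_add metric_field_differentiable maps differentiable1 differentiable2
          hess_differentiable w)
  qed
qed

section \<open>Tangential and normal parts\<close>

text \<open>The coordinates, in the domain, of the orthogonal projection of \<open>v\<close> to the
  tangent space. Defining it as a Riesz representative makes \<open>riesz_differentiable\<close>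
  applicable to tangential parts of fields.\<close>

definition tangential :: "'e \<Rightarrow> 'f \<Rightarrow> 'e" where
  "tangential w v = (THE a. \<forall>z. g w a z = G (f w) v (ddir f w z))"

lemma induced_tangential:
  assumes "w \<in> U"
  shows "g w (tangential w v) z = G (f w) v (ddir f w z)"
proof -
  interpret inner_form "g w" by (rule inner_form_induced[OF assms])
  have "linear (\<lambda>z. G (f w) v (ddir f w z))"
    by (auto intro!: linearI simp: ddir_f_simps assms metric_simps maps)
  from theI'[OF riesz[OF this]] show ?thesis
    by (simp add: tangential_def)
qed

lemma tangential_eqI:
  assumes "w \<in> U" "\<And>z. g w a z = G (f w) v (ddir f w z)"
  shows "tangential w v = a"
  by (rule induced.metric_eqI[OF assms(1)]) (simp add: assms induced_tangential)

lemma tangential_differentiable: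
  assumes "u \<in> U" "A differentiable (at u)"
  shows "(\<lambda>w. tangential w (A w)) differentiable (at u)"
proof (rule riesz_differentiable[OF open_domain assms(1) inner_form_induced])
  show "(\<lambda>w. g w x y) differentiable at u" for x y
    by (rule induced.metric_differentiable[OF assms(1)])
  show "(\<lambda>w. G (f w) (A w) (ddir f w z)) differentiable at u" for z
    by (intro metric_field_differentiable maps differentiable1 differentiable2 assms)
qed (auto intro: induced_tangential)

lemma normal_spaceD: "v \<in> normal_space G f w \<Longrightarrow> G (f w) v (ddir f w z) = 0"
  by (simp add: normal_space_def)

lemma tangential_normal: "w \<in> U \<Longrightarrow> v \<in> normal_space G f w \<Longrightarrow> tangential w v = 0"
  by (rule tangential_eqI) (simp_all add: normal_spaceD induced.metric_simps)

lemma tangential_ddir: "w \<in> U \<Longrightarrow> tangential w (ddir f w a) = a"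
  by (rule tangential_eqI) (simp_all add: induced_metric_def)

lemma linear_tangential:
  assumes "w \<in> U"
  shows "linear (tangential w)"
  by (rule linearI; rule tangential_eqI[OF assms];
      simp add: induced_tangential assms metric_simps induced.metric_simps maps)

lemma normal_part_eq:
  assumes "w \<in> U"
  shows "normal_part G f w v = v - ddir f w (tangential w v)"
  unfolding normal_part_def
proof (rule the_equality)
  have "v - ddir f w (tangential w v) \<in> normal_space G f w"
    using induced_tangential[OF assms, of v]
    by (simp add: normal_space_def metric_simps maps assms induced_metric_def)
  then show "v - ddir f w (tangential w v) \<in> normal_space G f w \<and>
      v - (v - ddir f w (tangential w v)) \<in> range (frechet_derivative f (at w))"
    by simp
  fix W assume W: "W \<in> normal_space G f w \<and> v - W \<in> range (frechet_derivative f (at w))"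
  then obtain a where a: "v - W = ddir f w a" by auto
  then have v: "v = W + ddir f w a" by (simp add: algebra_simps)
  have "tangential w v = a"
    unfolding v using W
    by (simp add: linear_add[OF linear_tangential[OF assms]] tangential_normal tangential_ddir assms)
  then show "W = v - ddir f w (tangential w v)"
    using v by simp
qed

lemma normal_part_normal: "w \<in> U \<Longrightarrow> normal_part G f w v \<in> normal_space G f w"
  using induced_tangential[of w v]
  by (simp add: normal_part_eq normal_space_def metric_simps maps induced_metric_def)

lemma linear_normal_part:
  assumes "w \<in> U"
  shows "linear (normal_part G f w)"
  by (rule linearI)
     (simp_all add: normal_part_eq assms linear_add[OF linear_tangential] linear_scale[OF linear_tangential]
       ddir_f_simps algebra_simps)

lemma normal_part_ddir: "w \<in> U \<Longrightarrow> normal_part G f w (ddir f w a) = 0"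
  by (simp add: normal_part_eq tangential_ddir)

text \<open>Of the six \<open>hess\<close> terms in the Koszul expression, four cancel by symmetry
  of \<open>hess\<close> and two coincide.\<close>

lemma christoffel_induced:
  assumes "w \<in> U"
  shows "christoffel g w X Y = tangential w (hess X Y w)"
proof (rule induced.christoffel_eqI[OF assms])
  fix Z
  have d: "ddir (\<lambda>w. g w X Y) w Z = G (f w) (hess Z X w) (ddir f w Y) + G (f w) (ddir f w X) (hess Z Y w)" for X Y Z
    by (rule ddir_eq[OF induced_has_derivative[OF assms]])
  note c = hess_commute[OF assms] metric_commute[OF maps[OF assms]]
  show "g w (tangential w (hess X Y w)) Z = induced.koszul w X Y Z"
    unfolding induced_tangential[OF assms] induced.koszul_def d
    using c(1)[of X Y] c(1)[of X Z] c(1)[of Y Z] c(2)[of "hess X Z w"] c(2)[of "hess Y Z w"]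
    by simp
qed

lemma second_fundamental_form_eq:
  "w \<in> U \<Longrightarrow> h w X Y = hess X Y w - ddir f w (christoffel g w X Y)"
  by (simp add: second_fundamental_form_def normal_part_eq christoffel_induced)

lemma second_fundamental_form_normal: "w \<in> U \<Longrightarrow> h w X Y \<in> normal_space G f w"
  by (simp add: second_fundamental_form_def normal_part_normal)

lemma second_fundamental_form_commute: "w \<in> U \<Longrightarrow> h w X Y = h w Y X"
  by (simp add: second_fundamental_form_def hess_commute)

lemma bilinear_second_fundamental_form:
  assumes "w \<in> U"
  shows "bilinear (h w)"
proof -
  have "linear (\<lambda>X. hess X Y w)" for Y
    using linear_ddir[OF differentiable2[OF assms, of Y]] bilinear_christoffel[OF maps[OF assms]]
    by (auto intro!: linearI simp: cov_deriv_def linear_add linear_scale ddir_f_simps assms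
        bilinear_ladd bilinear_lmul algebra_simps)
  then have *: "linear (\<lambda>X. h w X Y)" for Y
    using linear_compose[OF _ linear_normal_part[OF assms]]
    by (fastforce simp: second_fundamental_form_def o_def)
  have "(\<lambda>X. h w X Y) = h w Y" for Y
    by (rule ext) (rule second_fundamental_form_commute[OF assms])
  with * have "linear (h w Y)" for Y
    by metis
  then show ?thesis
    using * by (simp add: bilinear_def)
qed

lemma metric_normal_hess:
  assumes "w \<in> U" "v \<in> normal_space G f w"
  shows "G (f w) v (hess X Y w) = G (f w) v (h w X Y)"
  using normal_spaceD[OF assms(2)]
  by (simp add: second_fundamental_form_eq assms metric_simps maps)

lemma tangent_field_has_derivative:
  assumes "u \<in> U" "T differentiable (at u)"
  shows "((\<lambda>w. ddir f w (T w)) has_derivative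
    (\<lambda>X. ddir (\<lambda>w. ddir f w (T u)) u X + ddir f u (ddir T u X))) (at u)"
proof -
  \<comment> \<open>The dummy real argument, evaluated at 1, turns a field of linear maps into one
    of bilinear maps, so that the general product rule applies.\<close>
  define \<beta> where "\<beta> w a r = r *\<^sub>R ddir f w a" for w a and r :: real
  have "((\<lambda>w. \<beta> (id w) (T w) 1) has_derivative (\<lambda>X. ddir (\<lambda>y. \<beta> y (T u) 1) (id u) (id X)
      + \<beta> (id u) (ddir T u X) 1 + \<beta> (id u) (T u) 0)) (at u)"
  proof (rule has_derivative_bilinear_field[OF open_domain])
    show "bilinear (\<beta> y)" if "y \<in> U" for y
      unfolding bilinear_def \<beta>_def
      by (auto intro!: linearI simp: ddir_f_simps that algebra_simps)
    show "(\<lambda>y. \<beta> y a b) differentiable at (id u)" for a b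
      unfolding \<beta>_def using assms(1) by (intro derivative_intros differentiable2) simp
  qed (use assms in \<open>auto intro: differentiable_has_ddir has_derivative_id\<close>)
  then show ?thesis
    by (simp add: \<beta>_def)
qed

lemma cov_deriv_tangent_field:
  assumes "u \<in> U" "T differentiable (at u)"
  shows "cov_deriv G f X (\<lambda>w. ddir f w (T w)) u = ddir f u (ddir T u X) + hess X (T u) u"
  using ddir_eq[OF tangent_field_has_derivative[OF assms], of X] by (simp add: cov_deriv_def)

lemma second_fundamental_form_differentiable:
  assumes "u \<in> U"
  shows "(\<lambda>w. h w X Y) differentiable (at u)"
  by (rule differentiable_cong_open[OF open_domain assms second_fundamental_form_eq], assumption)
     (intro derivative_intros hess_differentiable assms induced.christoffel_differentiable
       differentiableI[OF tangent_field_has_derivative])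

text \<open>The Weingarten formula: differentiate the vanishing product of the normal field
  \<open>A\<close> with a coordinate tangent field.\<close>

lemma metric_cov_deriv_normal:
  assumes "u \<in> U" "open N" "u \<in> N" "A differentiable (at u)" "\<And>w. w \<in> N \<Longrightarrow> A w \<in> normal_space G f w"
  shows "G (f u) (cov_deriv G f X A u) (ddir f u Y) = - G (f u) (A u) (h u X Y)"
proof -
  have "ddir (\<lambda>w. G (f w) (A w) (ddir f w Y)) u X = ddir (\<lambda>w. 0) u X"
    by (rule ddir_cong_open[OF assms(2,3)]) (simp add: normal_spaceD assms(5))
  then have "G (f u) (cov_deriv G f X A u) (ddir f u Y) + G (f u) (A u) (hess X Y u) = 0"
    using ddir_metric_field[OF maps[OF assms(1)] differentiable1[OF assms(1)] assms(4) differentiable2[OF assms(1)], of Y X]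
    by simp
  then show ?thesis
    using metric_normal_hess[OF assms(1) assms(5)[OF assms(3)], of X Y] by simp
qed

text \<open>Differentiate the splitting of \<open>hess Y Z\<close> into \<open>h\<close> and the
  image of the induced Christoffel term, and pair with a tangent vector. The normal piece
  contributes a product of two values of \<open>h\<close> by Weingarten, the tangent piece the
  intrinsic derivative; antisymmetrise in \<open>X\<close> and \<open>Y\<close>.\<close>

theorem gauss_equation:
  assumes "u \<in> U"
  shows "g u (curvature g u X Y Z) W =
    G (f u) (curvature G (f u) (ddir f u X) (ddir f u Y) (ddir f u Z)) (ddir f u W)
    + G (f u) (h u Y Z) (h u X W) - G (f u) (h u X Z) (h u Y W)"
proof -
  note fu = maps[OF assms]
  have *: "G (f u) (cov_deriv G f X (hess Y Z) u) (ddir f u W)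
      = g u (cov_deriv g id X (\<lambda>w. christoffel g w Y Z) u) W - G (f u) (h u Y Z) (h u X W)" for X Y
  proof -
    let ?T = "\<lambda>w. christoffel g w Y Z"
    have T: "?T differentiable (at u)"
      by (rule induced.christoffel_differentiable[OF assms])
    have "cov_deriv G f X (\<lambda>w. h w Y Z) u = cov_deriv G f X (\<lambda>w. hess Y Z w - ddir f w (?T w)) u"
      by (rule cov_deriv_cong_open[OF open_domain assms second_fundamental_form_eq])
    also have "\<dots> = cov_deriv G f X (hess Y Z) u - (ddir f u (ddir ?T u X) + hess X (?T u) u)"
      using cov_deriv_diff[of f u "hess Y Z" "\<lambda>w. ddir f w (?T w)", OF fu hess_differentiable[OF assms]
          differentiableI[OF tangent_field_has_derivative[OF assms T]]]
      by (simp add: cov_deriv_tangent_field[OF assms T])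
    finally have "G (f u) (cov_deriv G f X (hess Y Z) u) (ddir f u W)
        = G (f u) (cov_deriv G f X (\<lambda>w. h w Y Z) u) (ddir f u W) + G (f u) (ddir f u (ddir ?T u X)) (ddir f u W)
          + G (f u) (hess X (?T u) u) (ddir f u W)"
      by (simp add: metric_simps fu)
    also have "G (f u) (cov_deriv G f X (\<lambda>w. h w Y Z) u) (ddir f u W) = - G (f u) (h u Y Z) (h u X W)"
      by (rule metric_cov_deriv_normal[OF assms open_domain assms second_fundamental_form_differentiable[OF assms]
            second_fundamental_form_normal])
    also have "G (f u) (hess X (?T u) u) (ddir f u W) = g u (christoffel g u X (?T u)) W"
      by (simp add: christoffel_induced induced_tangential assms)
    finally show ?thesis
      by (simp add: cov_deriv_def[of g] induced.metric_simps assms induced_metric_def[of G f u "ddir ?T u X"])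
  qed
  have c: "cov_deriv g id Y (\<lambda>_. Z) = (\<lambda>w. christoffel g w Y Z)" for Y
    by (rule ext) (simp add: cov_deriv_def)
  have "curvature G (f u) (ddir f u X) (ddir f u Y) (ddir f u Z)
      = cov_deriv G f X (hess Y Z) u - cov_deriv G f Y (hess X Z) u"
    using cov_deriv_curvature[of f u U "\<lambda>w. ddir f w Z", OF fu open_domain assms differentiable1 differentiable2
        differentiable2 differentiable3] by simp
  then show ?thesis
    by (simp add: metric_simps fu * induced.metric_simps assms curvature_def c)
qed

lemma induced_shape_operator:
  assumes "u \<in> U"
  shows "g u (shape_operator G f u \<xi> X) Y = G (f u) (h u X Y) \<xi>"
proof -
  interpret inner_form "g u" by (rule inner_form_induced[OF assms])
  have "linear (\<lambda>Y. G (f u) (h u X Y) \<xi>)"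
    using bilinear_second_fundamental_form[OF assms]
    by (auto intro!: linearI simp: bilinear_radd bilinear_rmul metric_simps maps assms)
  from theI'[OF riesz[OF this]] show ?thesis
    by (simp add: shape_operator_def)
qed

lemma shape_operator_eqI:
  assumes "u \<in> U" "\<And>Y. g u W Y = G (f u) (h u X Y) \<xi>"
  shows "shape_operator G f u \<xi> X = W"
  by (rule induced.metric_eqI[OF assms(1)]) (simp add: assms induced_shape_operator)

text \<open>The inner normal derivative is the full one minus the image of its tangential part,
  which at \<open>u\<close> is minus the shape operator applied to \<open>Y\<close>. Differentiating
  that image adds a value of \<open>h\<close>, and the full derivatives commute up to ambient
  curvature.\<close>

theorem ricci_equation:
  assumes u: "u \<in> U" and N: "open N" "u \<in> N"
    and d1: "\<And>w. w \<in> N \<Longrightarrow> \<xi> differentiable (at w)"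
    and d2: "\<And>w X. w \<in> N \<Longrightarrow> (\<lambda>w. ddir \<xi> w X) differentiable (at w)"
    and normal: "\<And>w. w \<in> N \<Longrightarrow> \<xi> w \<in> normal_space G f w"
  shows "normal_curvature G f X Y \<xi> u =
    normal_part G f u (curvature G (f u) (ddir f u X) (ddir f u Y) (\<xi> u))
    + h u X (shape_operator G f u (\<xi> u) Y) - h u Y (shape_operator G f u (\<xi> u) X)"
proof -
  note fu = maps[OF u]
  define D where "D Y = cov_deriv G f Y \<xi>" for Y
  have O: "open (N \<inter> U)" "u \<in> N \<inter> U"
    using N u open_domain by auto
  have D: "D Y differentiable (at w)" if "w \<in> N \<inter> U" for Y w
    unfolding D_def using that
    by (intro cov_deriv_differentiable maps differentiable1 differentiable2 d1 d2) auto
  have tan: "tangential u (D Y u) = - shape_operator G f u (\<xi> u) Y" for Y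
  proof (rule tangential_eqI[OF u])
    fix z
    show "g u (- shape_operator G f u (\<xi> u) Y) z = G (f u) (D Y u) (ddir f u z)"
      using metric_cov_deriv_normal[OF u N d1[OF N(2)] normal, of Y z]
      by (simp add: D_def induced.metric_simps induced_shape_operator u metric_commute[OF fu, of "\<xi> u"])
  qed
  have second: "normal_connection G f X (normal_connection G f Y \<xi>) u
      = normal_part G f u (cov_deriv G f X (D Y) u) + h u X (shape_operator G f u (\<xi> u) Y)" for X Y
  proof -
    let ?T = "\<lambda>w. tangential w (D Y w)"
    have T: "?T differentiable (at u)"
      by (rule tangential_differentiable[OF u D[OF O(2)]])
    have "cov_deriv G f X (normal_connection G f Y \<xi>) u = cov_deriv G f X (\<lambda>w. D Y w - ddir f w (?T w)) u"
      by (rule cov_deriv_cong_open[OF O]) (simp add: normal_connection_def D_def normal_part_eq)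
    also have "\<dots> = cov_deriv G f X (D Y) u - (ddir f u (ddir ?T u X) + hess X (?T u) u)"
      using cov_deriv_diff[of f u "D Y" "\<lambda>w. ddir f w (?T w)", OF fu D[OF O(2)]
          differentiableI[OF tangent_field_has_derivative[OF u T]]]
      by (simp add: cov_deriv_tangent_field[OF u T])
    finally have "normal_connection G f X (normal_connection G f Y \<xi>) u
        = normal_part G f u (cov_deriv G f X (D Y) u) - h u X (?T u)"
      by (simp add: normal_connection_def linear_diff[OF linear_normal_part[OF u]]
          linear_add[OF linear_normal_part[OF u]] normal_part_ddir u second_fundamental_form_def)
    then show ?thesis
      by (simp add: tan bilinear_rneg[OF bilinear_second_fundamental_form[OF u]])
  qed
  have "cov_deriv G f X (D Y) u - cov_deriv G f Y (D X) u = curvature G (f u) (ddir f u X) (ddir f u Y) (\<xi> u)"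
    unfolding D_def
    by (rule cov_deriv_curvature[of f u "N \<inter> U" \<xi>, OF fu O]) (auto intro: differentiable1 differentiable2 d1 d2)
  then show ?thesis
    unfolding normal_curvature_def second
    using linear_diff[OF linear_normal_part[OF u], of "cov_deriv G f X (D Y) u" "cov_deriv G f Y (D X) u"]
    by simp
qed

end

section \<open>Casorati curvatures at a point\<close>

lemma sum_symmetric_off_diagonal:
  fixes a :: "nat \<Rightarrow> nat \<Rightarrow> real"
  assumes "\<And>i j. a i j = a j i"
  shows "2 * (\<Sum>j = 1..n. \<Sum>i = 1..<j. a i j) = (\<Sum>i = 1..n. \<Sum>j = 1..n. a i j) - (\<Sum>i = 1..n. a i i)"
proof (induction n)
  case (Suc n)
  have "{1..<Suc n} = {1..n}" by auto
  then show ?case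
    using Suc sum.cong[of "{1..n}" "{1..n}" "a (Suc n)" "\<lambda>i. a i (Suc n)", OF refl assms]
    by (simp add: sum.distrib)
qed simp

text \<open>The Gauss and Ricci equations at \<open>u\<close> see the ambient curvature at
  \<open>f u\<close> only, so the curvature hypothesis is pointwise. The dimension bounds keep n - 1
  nonzero and make n + 1 a normal index.\<close>

locale space_form_immersion = immersed_patch V G U f
  for V :: "'f::euclidean_space set" and G :: "'f metric"
    and U :: "'e::euclidean_space set" and f :: "'e \<Rightarrow> 'f" +
  fixes u :: 'e and c :: real
  assumes point: "u \<in> U"
    and codimension: "DIM('e) < DIM('f)"
    and dimension: "DIM('e) \<ge> 2"
    and sectional: "X \<noteq> Y \<Longrightarrow> independent {X, Y} \<Longrightarrow> sectional_curvature G (f u) X Y = c"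
begin

sublocale tangent: inner_form "g u"
  by (rule inner_form_induced[OF point])

sublocale ambient: inner_form "G (f u)"
  by (rule inner_form_metric[OF maps[OF point]])

abbreviation "sq v \<equiv> G (f u) v v"

lemmas bilinear_h = bilinear_second_fundamental_form[OF point]
lemmas h_commute = second_fundamental_form_commute[OF point]
lemmas h_simps = bilinear_ladd[OF bilinear_h] bilinear_radd[OF bilinear_h]
  bilinear_lmul[OF bilinear_h] bilinear_rmul[OF bilinear_h]

lemma linear_h: "linear (h u X)" "linear (\<lambda>X. h u X Y)"
  using bilinear_h by (auto simp: bilinear_def)

lemma orthonormal_basis_iff:
  "orthonormal_basis (g u) L e \<longleftrightarrow> tangent.orthonormal {1..dim L} e \<and> span (e ` {1..dim L}) = L"
  by (auto simp: orthonormal_basis_def tangent.orthonormal_def)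

lemma orthonormal_basis_some:
  assumes "subspace L"
  shows "orthonormal_basis (g u) L (SOME e. orthonormal_basis (g u) L e)"
proof -
  obtain e where "tangent.orthonormal {1..dim L} e" "span (e ` {1..dim L}) = L"
    by (rule tangent.orthonormal_exists[of "{1..dim L}" L]) (use assms in auto)
  then have "orthonormal_basis (g u) L e"
    by (simp add: orthonormal_basis_iff)
  then show ?thesis
    by (rule someI[of "orthonormal_basis (g u) L"])
qed

section \<open>Normal frames\<close>

text \<open>The differential is isometric for the induced metric, so it maps a tangent frame to an
  orthonormal family. Completing this to an ambient basis, the added members span exactly the normal
  space.\<close>

lemma dim_normal_space: "dim (normal_space G f u) = DIM('f) - DIM('e)"
  and subspace_normal_space: "subspace (normal_space G f u)"
proof -
  let ?N = "normal_space G f u" and ?J = "{DIM('e) + 1..DIM('f)}"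
  obtain e where e: "tangent.orthonormal {1..DIM('e)} e" "span (e ` {1..DIM('e)}) = UNIV"
    by (rule tangent.orthonormal_exists[of "{1..DIM('e)}" UNIV]) auto
  have "ambient.orthonormal {1..DIM('e)} (ddir f u \<circ> e)"
    using e(1) by (auto simp: ambient.orthonormal_def tangent.orthonormal_def induced_metric_def)
  from ambient.orthonormal_extend[OF _ _ this, of "{1..DIM('f)}" UNIV] codimension
  obtain e' where e': "ambient.orthonormal {1..DIM('f)} e'" "\<forall>i\<in>{1..DIM('e)}. e' i = ddir f u (e i)"
    by auto
  have full: "span (e' ` {1..DIM('f)}) = UNIV"
    by (rule ambient.orthonormal_spans[OF e'(1)]) auto
  have "e' r \<in> ?N" if r: "r \<in> ?J" for r
  proof -
    have "G (f u) (e' r) (ddir f u X) = 0" for X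
    proof -
      have "X = (\<Sum>i = 1..DIM('e). g u X (e i) *\<^sub>R e i)"
        using tangent.orthonormal_expansion[OF e(1)] e(2) by simp
      then have "ddir f u X = ddir f u (\<Sum>i = 1..DIM('e). g u X (e i) *\<^sub>R e i)"
        by simp
      also have "\<dots> = (\<Sum>i = 1..DIM('e). g u X (e i) *\<^sub>R e' i)"
        using e'(2) by (simp add: linear_sum[OF linear_ddir_f[OF point]] ddir_f_simps point)
      also have "G (f u) (e' r) \<dots> = (\<Sum>i = 1..DIM('e). g u X (e i) * G (f u) (e' r) (e' i))"
        by (simp add: ambient.form_sum_right ambient.form_simps)
      also have "\<dots> = 0"
        using r codimension e'(1) by (intro sum.neutral) (auto simp: ambient.orthonormal_def)
      finally show ?thesis .
    qed
    then show ?thesis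
      by (simp add: normal_space_def)
  qed
  moreover show sub: "subspace ?N"
    by (auto simp: subspace_def normal_space_def ambient.form_simps)
  ultimately have "span (e' ` ?J) \<subseteq> ?N"
    by (intro span_minimal) auto
  moreover have "W \<in> span (e' ` ?J)" if "W \<in> ?N" for W
  proof -
    have "W = (\<Sum>r = 1..DIM('f). G (f u) W (e' r) *\<^sub>R e' r)"
      using ambient.orthonormal_expansion[OF e'(1)] full by simp
    also have "\<dots> = (\<Sum>r\<in>?J. G (f u) W (e' r) *\<^sub>R e' r)"
      by (rule sum.mono_neutral_right) (use e'(2) normal_spaceD[OF that] in auto)
    finally show ?thesis
      by (metis (no_types, lifting) image_eqI span_base span_mul span_sum)
  qed
  ultimately have "?N = span (e' ` ?J)"
    by auto
  moreover have "ambient.orthonormal ?J e'"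
    using e'(1) by (rule ambient.orthonormal_subset) auto
  ultimately show "dim ?N = DIM('f) - DIM('e)"
    using ambient.orthonormal_dim[of ?J e'] by simp
qed

text \<open>A normal frame is defined without a spanning condition; there are as many members as the
  normal space has dimensions, which supplies it.\<close>

lemma normal_frame_iff:
  "normal_frame G f u \<xi> \<longleftrightarrow>
    ambient.orthonormal {DIM('e) + 1..DIM('f)} \<xi> \<and> span (\<xi> ` {DIM('e) + 1..DIM('f)}) = normal_space G f u"
proof
  assume nf: "normal_frame G f u \<xi>"
  then have o: "ambient.orthonormal {DIM('e) + 1..DIM('f)} \<xi>"
    by (auto simp: normal_frame_def ambient.orthonormal_def)
  moreover have "span (\<xi> ` {DIM('e) + 1..DIM('f)}) = normal_space G f u"
    by (rule ambient.orthonormal_spans[OF o _ subspace_normal_space])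
       (use nf in \<open>auto simp: normal_frame_def dim_normal_space\<close>)
  ultimately show "ambient.orthonormal {DIM('e) + 1..DIM('f)} \<xi> \<and> span (\<xi> ` {DIM('e) + 1..DIM('f)}) = normal_space G f u"
    by simp
next
  assume "ambient.orthonormal {DIM('e) + 1..DIM('f)} \<xi> \<and> span (\<xi> ` {DIM('e) + 1..DIM('f)}) = normal_space G f u"
  then show "normal_frame G f u \<xi>"
    using span_superset[of "\<xi> ` {DIM('e) + 1..DIM('f)}"]
    by (auto simp: normal_frame_def ambient.orthonormal_def)
qed

lemma normal_frame_extend:
  assumes "ambient.orthonormal I \<xi>" "\<xi> ` I \<subseteq> normal_space G f u" "I \<subseteq> {DIM('e) + 1..DIM('f)}"
  obtains \<eta> where "normal_frame G f u \<eta>" "\<And>r. r \<in> I \<Longrightarrow> \<eta> r = \<xi> r"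
proof -
  from ambient.orthonormal_extend[OF _ assms(3,1,2) subspace_normal_space]
  obtain \<eta> where \<eta>: "ambient.orthonormal {DIM('e) + 1..DIM('f)} \<eta>" "\<forall>i\<in>I. \<eta> i = \<xi> i"
    "\<eta> ` {DIM('e) + 1..DIM('f)} \<subseteq> normal_space G f u"
    by (auto simp: dim_normal_space)
  then have "normal_frame G f u \<eta>"
    using ambient.orthonormal_spans[OF \<eta>(1,3) subspace_normal_space]
    by (simp add: normal_frame_iff dim_normal_space)
  then show ?thesis
    using that \<eta>(2) by blast
qed

lemma normal_frame_exists: "\<exists>\<xi>. normal_frame G f u \<xi>"
  using normal_frame_extend[of "{}" undefined] by (auto simp: ambient.orthonormal_def)

section \<open>Casorati and scalar curvature in an arbitrary frame\<close>

text \<open>Removes both \<open>SOME\<close> choices: Parseval in the normal frame turns the sum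
  over \<open>r\<close> into a squared length, and trace invariance then changes the tangent basis
  in one argument of \<open>h\<close> at a time.\<close>

lemma casorati_curvature_eq:
  assumes e: "orthonormal_basis (g u) L e"
  shows "casorati_curvature L G f u = (\<Sum>i = 1..dim L. \<Sum>j = 1..dim L. sq (h u (e i) (e j))) / dim L"
proof -
  let ?I = "{1..dim L}"
  define d where "d = (SOME e. orthonormal_basis (g u) L e)"
  define \<xi> where "\<xi> = (SOME \<xi>. normal_frame G f u \<xi>)"
  have L: "subspace L"
    using e unfolding orthonormal_basis_iff by (metis subspace_span)
  have d: "orthonormal_basis (g u) L d"
    unfolding d_def by (rule orthonormal_basis_some[OF L])
  have \<xi>: "normal_frame G f u \<xi>"
    unfolding \<xi>_def by (rule someI_ex[OF normal_frame_exists])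
  have trace: "(\<Sum>i\<in>?I. \<beta> (d i) (d i)) = (\<Sum>i\<in>?I. \<beta> (e i) (e i))" if "bilinear \<beta>" for \<beta> :: "'e \<Rightarrow> 'e \<Rightarrow> real"
    by (rule tangent.trace_invariant[OF that]) (use d e in \<open>auto simp: orthonormal_basis_iff\<close>)
  have bil: "bilinear (\<lambda>Y Y'. G (f u) (h u X Y) (h u X Y'))" for X
    by (auto simp: bilinear_def h_simps ambient.form_simps intro!: linearI)
  have "(\<Sum>r = DIM('e) + 1..DIM('f). \<Sum>i\<in>?I. \<Sum>j\<in>?I. (G (f u) (h u (d i) (d j)) (\<xi> r))\<^sup>2)
      = (\<Sum>i\<in>?I. \<Sum>r = DIM('e) + 1..DIM('f). \<Sum>j\<in>?I. (G (f u) (h u (d i) (d j)) (\<xi> r))\<^sup>2)"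
    by (rule sum.swap)
  also have "\<dots> = (\<Sum>i\<in>?I. \<Sum>j\<in>?I. \<Sum>r = DIM('e) + 1..DIM('f). (G (f u) (h u (d i) (d j)) (\<xi> r))\<^sup>2)"
    by (intro sum.cong sum.swap refl)
  also have "\<dots> = (\<Sum>i\<in>?I. \<Sum>j\<in>?I. sq (h u (d i) (d j)))"
    using \<xi> second_fundamental_form_normal[OF point]
    by (intro sum.cong refl ambient.parseval[symmetric]) (auto simp: normal_frame_iff)
  also have "\<dots> = (\<Sum>i\<in>?I. \<Sum>j\<in>?I. sq (h u (d i) (e j)))"
    by (intro sum.cong refl trace[OF bil])
  also have "\<dots> = (\<Sum>j\<in>?I. \<Sum>i\<in>?I. sq (h u (e j) (d i)))"
    by (subst sum.swap) (simp add: h_commute)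
  also have "\<dots> = (\<Sum>i\<in>?I. \<Sum>j\<in>?I. sq (h u (e i) (e j)))"
    by (intro sum.cong refl trace[OF bil])
  finally show ?thesis
    by (simp add: casorati_curvature_def Let_def d_def \<xi>_def)
qed

text \<open>The Gauss equation traced twice in the chosen frame \<open>d\<close>, then carried over
  to \<open>e\<close> by invariance of the two resulting sums.\<close>

lemma normalized_scalar_curvature_eq:
  assumes e: "orthonormal_basis (g u) UNIV e"
  shows "normalized_scalar_curvature G f u = c +
    (sq (\<Sum>i = 1..DIM('e). h u (e i) (e i)) - (\<Sum>i = 1..DIM('e). \<Sum>j = 1..DIM('e). sq (h u (e i) (e j)))) / (DIM('e) * (real DIM('e) - 1))"
proof -
  let ?I = "{1..DIM('e)}"
  define d where "d = (SOME e. orthonormal_basis (g u) UNIV e)"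
  have d: "orthonormal_basis (g u) UNIV d"
    unfolding d_def by (rule orthonormal_basis_some) simp
  then have on: "tangent.orthonormal ?I d"
    by (simp add: orthonormal_basis_iff)
  \<comment> \<open>The Gauss value of the sectional curvature, extended by zero to the diagonal, so
    that the sum over i < j is half of the full double sum.\<close>
  define a where "a i j = (if i = j then 0 else c)
    + G (f u) (h u (d i) (d i)) (h u (d j) (d j)) - sq (h u (d i) (d j))" for i j
  have sec: "sectional_curvature g u (d i) (d j) = a i j" if "i \<in> ?I" "j \<in> ?I" "i \<noteq> j" for i j
  proof -
    have "G (f u) (curvature G (f u) (ddir f u (d i)) (ddir f u (d j)) (ddir f u (d j))) (ddir f u (d i))
        = c * (g u (d j) (d j) * g u (d i) (d i) - g u (d i) (d j) * g u (d j) (d i))"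
      by (simp add: constant_sectional_curvature[OF maps[OF point] sectional] induced_metric_def)
    then show ?thesis
      using that on
      by (simp add: sectional_curvature_def gauss_equation[OF point] tangent.orthonormal_def a_def
          h_commute[of "d j" "d i"] ambient.form_commute[of "h u (d j) (d j)"])
  qed
  have "2 * scalar_curvature g u = 2 * (\<Sum>j = 1..DIM('e). \<Sum>i = 1..<j. a i j)"
    unfolding scalar_curvature_def Let_def d_def[symmetric]
    by (intro arg_cong[of _ _ "(*) 2"] sum.cong refl sec) auto
  also have "\<dots> = (\<Sum>i = 1..DIM('e). \<Sum>j = 1..DIM('e). a i j) - (\<Sum>i = 1..DIM('e). a i i)"
    by (rule sum_symmetric_off_diagonal)
       (simp add: a_def h_commute ambient.form_commute)
  also have "\<dots> = (\<Sum>i = 1..DIM('e). \<Sum>j = 1..DIM('e). a i j)"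
    by (simp add: a_def)
  also have "\<dots> = c * (DIM('e) * (real DIM('e) - 1)) + sq (\<Sum>i = 1..DIM('e). h u (d i) (d i)) - (\<Sum>i = 1..DIM('e). \<Sum>j = 1..DIM('e). sq (h u (d i) (d j)))"
  proof -
    have "(\<Sum>j = 1..DIM('e). if i = j then 0 else c) = (real DIM('e) - 1) * c" if "i \<in> {1..DIM('e)}" for i
    proof -
      have "(\<Sum>j = 1..DIM('e). if i = j then 0 else c) = (\<Sum>j = 1..DIM('e). c - (if i = j then c else 0))"
        by (intro sum.cong) auto
      then show ?thesis
        using that by (simp add: sum_subtractf algebra_simps)
    qed
    then have "(\<Sum>i = 1..DIM('e). \<Sum>j = 1..DIM('e). if i = j then 0 else c) = c * (DIM('e) * (real DIM('e) - 1))"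
      by simp
    then show ?thesis
      unfolding a_def sum.distrib sum_subtractf
      by (subst ambient.form_sum_left, subst ambient.form_sum_right) simp
  qed
  also have "(\<Sum>i = 1..DIM('e). h u (d i) (d i)) = (\<Sum>i = 1..DIM('e). h u (e i) (e i))"
    by (rule tangent.trace_invariant[OF bilinear_h]) (use d e in \<open>auto simp: orthonormal_basis_iff\<close>)
  \<comment> \<open>Both sides are n times the Casorati curvature of \<open>UNIV\<close>.\<close>
  also have "(\<Sum>i = 1..DIM('e). \<Sum>j = 1..DIM('e). sq (h u (d i) (d j))) = (\<Sum>i = 1..DIM('e). \<Sum>j = 1..DIM('e). sq (h u (e i) (e j)))"
    using casorati_curvature_eq[OF d] casorati_curvature_eq[OF e] by simp
  finally have "2 * scalar_curvature g u = c * (DIM('e) * (real DIM('e) - 1)) + sq (\<Sum>i = 1..DIM('e). h u (e i) (e i))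
      - (\<Sum>i = 1..DIM('e). \<Sum>j = 1..DIM('e). sq (h u (e i) (e j)))" .
  moreover have "DIM('e) * (real DIM('e) - 1) \<noteq> 0"
    using dimension by auto
  ultimately show ?thesis
    unfolding normalized_scalar_curvature_def by (simp add: add_divide_distrib diff_divide_distrib)
qed

text \<open>The weights of the trace form that is extremal in the Cauchy-Schwarz inequality:
  \<open>diag(1, \<dots>, 1, 2)\<close>, the last direction being the one normal to the hyperplane.\<close>

definition weight :: "nat \<Rightarrow> nat \<Rightarrow> real" where
  "weight i j = (if i = j then if i = DIM('e) then 2 else 1 else 0)"

text \<open>This is the vector t of the overview. The divisor is n + 1, the trace of
  \<open>weight\<close>, so it is not the usual mean curvature vector.\<close>

definition mean :: "(nat \<Rightarrow> 'e) \<Rightarrow> 'f" where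
  "mean e = (1 / (real DIM('e) + 1)) *\<^sub>R (\<Sum>i = 1..DIM('e). h u (e i) (e i))"

text \<open>Used for m = n and m = n - 1; in both cases \<open>mean e\<close> and
  \<open>weight\<close> refer to the whole frame, so both sums measure the distance from the same
  model.\<close>

definition defect :: "nat \<Rightarrow> (nat \<Rightarrow> 'e) \<Rightarrow> real" where
  "defect m e = (\<Sum>i = 1..m. \<Sum>j = 1..m. sq (h u (e i) (e j) - weight i j *\<^sub>R mean e))"

lemma defect_nonneg: "defect m e \<ge> 0"
  unfolding defect_def by (intro sum_nonneg ambient.form_nonneg)

lemma defect_eq:
  "defect m e = (\<Sum>i = 1..m. \<Sum>j = 1..m. sq (h u (e i) (e j)))
    - 2 * (\<Sum>i = 1..m. weight i i * G (f u) (h u (e i) (e i)) (mean e))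
    + (\<Sum>i = 1..m. (weight i i)\<^sup>2) * sq (mean e)"
proof -
  have "(\<Sum>j = 1..m. sq (h u (e i) (e j) - weight i j *\<^sub>R mean e))
      = (\<Sum>j = 1..m. sq (h u (e i) (e j))) - 2 * (weight i i * G (f u) (h u (e i) (e i)) (mean e))
        + (weight i i)\<^sup>2 * sq (mean e)" if "i \<in> {1..m}" for i
  proof -
    have "(\<Sum>j = 1..m. sq (h u (e i) (e j) - weight i j *\<^sub>R mean e))
      = (\<Sum>j = 1..m. sq (h u (e i) (e j)) + (if j = i then (weight i i)\<^sup>2 * sq (mean e)
          - 2 * (weight i i * G (f u) (h u (e i) (e i)) (mean e)) else 0))"
      using ambient.form_commute[of "mean e" "h u (e i) (e i)"]
      by (intro sum.cong) (auto simp: weight_def ambient.form_simps power2_eq_square)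
    then show ?thesis
      using that by (simp add: sum.distrib)
  qed
  then show ?thesis
    by (simp add: defect_def sum.distrib sum_subtractf sum_distrib_left sum_distrib_right)
qed

text \<open>A diagonal entry with i < n occurs twice with weight 1, the last one once with weight 2,
  so the cross terms add up to a multiple of the trace H. The squared weights sum to 2 (n - 1) + 4 =
  2 (n + 1), and H = (n + 1) t leaves -2 (n + 1) |t|^2.\<close>

lemma defect_sum:
  "defect DIM('e) e + defect (DIM('e) - 1) e = (\<Sum>i = 1..DIM('e). \<Sum>j = 1..DIM('e). sq (h u (e i) (e j)))
    + (\<Sum>i = 1..DIM('e) - 1. \<Sum>j = 1..DIM('e) - 1. sq (h u (e i) (e j)))
    - 2 / (real DIM('e) + 1) * sq (\<Sum>i = 1..DIM('e). h u (e i) (e i))"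
proof -
  obtain k where k: "DIM('e) = Suc k"
    using dimension by (cases "DIM('e)") auto
  let ?H = "\<Sum>i = 1..DIM('e). h u (e i) (e i)"
  have w: "weight i i = 1" if "i \<in> {1..k}" for i
    using that by (auto simp: weight_def k)
  have wn: "weight (Suc k) (Suc k) = 2"
    by (simp add: weight_def k)
  have "(\<Sum>i = 1..k. weight i i * G (f u) (h u (e i) (e i)) (mean e))
      = (\<Sum>i = 1..k. G (f u) (h u (e i) (e i)) (mean e))"
    by (rule sum.cong) (auto simp: w)
  then have 1: "(\<Sum>i = 1..DIM('e). weight i i * G (f u) (h u (e i) (e i)) (mean e))
      + (\<Sum>i = 1..DIM('e) - 1. weight i i * G (f u) (h u (e i) (e i)) (mean e)) = 2 * G (f u) ?H (mean e)"
    unfolding k by (simp add: wn ambient.form_sum_left ambient.form_simps)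
  have "(\<Sum>i = 1..k. (weight i i)\<^sup>2) = real k"
    using w by simp
  then have 2: "(\<Sum>i = 1..DIM('e). (weight i i)\<^sup>2) + (\<Sum>i = 1..DIM('e) - 1. (weight i i)\<^sup>2) = 2 * (real DIM('e) + 1)"
    unfolding k by (simp add: wn)
  have "defect DIM('e) e + defect (DIM('e) - 1) e = (\<Sum>i = 1..DIM('e). \<Sum>j = 1..DIM('e). sq (h u (e i) (e j)))
    + (\<Sum>i = 1..DIM('e) - 1. \<Sum>j = 1..DIM('e) - 1. sq (h u (e i) (e j)))
    - 2 * (2 * G (f u) ?H (mean e)) + 2 * (real DIM('e) + 1) * sq (mean e)"
    unfolding defect_eq 1[symmetric] 2[symmetric] by (simp add: algebra_simps)
  moreover have H: "?H = (real DIM('e) + 1) *\<^sub>R mean e"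
    by (simp add: mean_def)
  have "G (f u) ?H (mean e) = (real DIM('e) + 1) * sq (mean e)"
    unfolding H by (simp add: ambient.form_simps)
  moreover have "2 / (real DIM('e) + 1) * sq ?H = 2 * ((real DIM('e) + 1) * sq (mean e))"
    unfolding H by (simp add: ambient.form_simps)
  ultimately show ?thesis
    by linarith
qed

section \<open>The infimum over hyperplanes\<close>

definition hyperplanes :: "'e set set" where
  "hyperplanes = {L. subspace L \<and> dim L = DIM('e) - 1}"

text \<open>\<open>delta_casorati\<close> with the infimum replaced by the value at one
  hyperplane.\<close>

definition casorati_mix :: "'e set \<Rightarrow> real" where
  "casorati_mix L = 1 / 2 * casorati_curvature UNIV G f u
    + (real DIM('e) + 1) / (2 * real DIM('e)) * casorati_curvature L G f u"

text \<open>\<open>orthonormal_basis\<close> for \<open>L\<close> reads only the first n - 1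
  members, so one sequence serves for \<open>L\<close> and for the whole space, with its last member
  normal to \<open>L\<close>.\<close>

lemma hyperplane_basis:
  assumes "L \<in> hyperplanes"
  obtains e where "orthonormal_basis (g u) UNIV e" "orthonormal_basis (g u) L e"
proof -
  have L: "subspace L" "dim L = DIM('e) - 1"
    using assms by (auto simp: hyperplanes_def)
  obtain d where d: "tangent.orthonormal {1..DIM('e) - 1} d" "d ` {1..DIM('e) - 1} \<subseteq> L" "span (d ` {1..DIM('e) - 1}) = L"
    by (rule tangent.orthonormal_exists[of "{1..DIM('e) - 1}" L]) (use L in auto)
  from tangent.orthonormal_extend[OF _ _ d(1), of "{1..DIM('e)}" UNIV]
  obtain e where e: "tangent.orthonormal {1..DIM('e)} e" "\<forall>i\<in>{1..DIM('e) - 1}. e i = d i"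
    by auto
  have "e ` {1..DIM('e) - 1} = d ` {1..DIM('e) - 1}"
    using e(2) by (intro image_cong) auto
  then have "orthonormal_basis (g u) L e"
    using d(1,3) e(2) L by (simp add: orthonormal_basis_iff tangent.orthonormal_def)
  moreover have "orthonormal_basis (g u) UNIV e"
    using e(1) tangent.orthonormal_spans[OF e(1), of UNIV] by (simp add: orthonormal_basis_iff)
  ultimately show ?thesis
    using that by blast
qed

lemma basis_hyperplane:
  assumes "orthonormal_basis (g u) UNIV e"
  shows "span (e ` {1..DIM('e) - 1}) \<in> hyperplanes" "orthonormal_basis (g u) (span (e ` {1..DIM('e) - 1})) e"
proof -
  have on: "tangent.orthonormal {1..DIM('e) - 1} e"
    by (rule tangent.orthonormal_subset[of "{1..DIM('e)}"]) (use assms in \<open>auto simp: orthonormal_basis_iff\<close>)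
  then have "dim (span (e ` {1..DIM('e) - 1})) = DIM('e) - 1"
    using tangent.orthonormal_dim by fastforce
  then show "span (e ` {1..DIM('e) - 1}) \<in> hyperplanes" "orthonormal_basis (g u) (span (e ` {1..DIM('e) - 1})) e"
    using on by (auto simp: hyperplanes_def orthonormal_basis_iff)
qed

text \<open>This explains the coefficient (n + 1) / (2n): over the denominator 2n (n - 1),
  \<open>S\<close> collects n - 1 from the Casorati curvature and 2 from the scalar curvature, and
  \<open>S'\<close> gets the same factor n + 1.\<close>

lemma casorati_gap:
  assumes "L \<in> hyperplanes" "orthonormal_basis (g u) UNIV e" "orthonormal_basis (g u) L e"
  shows "casorati_mix L + c - normalized_scalar_curvature G f u
    = (real DIM('e) + 1) / (2 * real DIM('e) * (real DIM('e) - 1)) * (defect DIM('e) e + defect (DIM('e) - 1) e)"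
proof -
  have dim: "dim L = DIM('e) - 1" "real (DIM('e) - 1) = real DIM('e) - 1"
    using assms(1) dimension by (auto simp: hyperplanes_def)
  have alg: "1 / 2 * (S / N) + (N + 1) / (2 * N) * (S' / (N - 1)) + c - (c + (H - S) / (N * (N - 1)))
      = (N + 1) / (2 * N * (N - 1)) * (S + S' - 2 / (N + 1) * H)" if "N > 1" for S S' H N :: real
  proof -
    have "1 / 2 * (S / N) + (N + 1) / (2 * N) * (S' / (N - 1)) + c - (c + (H - S) / (N * (N - 1)))
        = ((N - 1) * S + (N + 1) * S' - 2 * (H - S)) / (2 * N * (N - 1))"
      using that by (simp add: divide_simps) (simp add: algebra_simps)
    also have "(N - 1) * S + (N + 1) * S' - 2 * (H - S) = (N + 1) * (S + S') - 2 * H"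
      by (simp add: algebra_simps)
    also have "\<dots> = (N + 1) * (S + S' - 2 / (N + 1) * H)"
      using that by (simp add: right_diff_distrib)
    finally show ?thesis
      by simp
  qed
  show ?thesis
    unfolding casorati_mix_def casorati_curvature_eq[OF assms(2)] casorati_curvature_eq[OF assms(3)]
      normalized_scalar_curvature_eq[OF assms(2)] defect_sum dim dim_UNIV
    by (rule alg) (use dimension in auto)
qed

text \<open>A hyperplane is encoded by a unit normal. Its Casorati curvature is then a continuous
  function of that vector on the compact unit sphere of the induced metric.\<close>

lemma hyperplane_minimal: "\<exists>L0\<in>hyperplanes. \<forall>L\<in>hyperplanes. casorati_curvature L0 G f u \<le> casorati_curvature L G f u"
proof -
  obtain k where k: "DIM('e) = Suc k" "k > 0"
    using dimension by (cases "DIM('e)") auto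
  define d where "d = (SOME e. orthonormal_basis (g u) UNIV e)"
  have d: "orthonormal_basis (g u) UNIV d"
    unfolding d_def by (rule orthonormal_basis_some) simp
  \<comment> \<open>Inclusion-exclusion: delete the row and the column of \<open>v\<close> from the
    full sum and restore the corner that was removed twice. The trace over \<open>d\<close> keeps
    this independent of a completion of \<open>v\<close>.\<close>
  define \<Phi> where "\<Phi> v = (\<Sum>i = 1..DIM('e). \<Sum>j = 1..DIM('e). sq (h u (d i) (d j)))
    - 2 * (\<Sum>i = 1..DIM('e). sq (h u (d i) v)) + sq (h u v v)" for v
  have val: "casorati_curvature L G f u = \<Phi> (e DIM('e)) / k"
    if L: "L \<in> hyperplanes" and e: "orthonormal_basis (g u) UNIV e" "orthonormal_basis (g u) L e" for L e
  proof -
    have dim: "dim L = k"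
      using L k by (simp add: hyperplanes_def)
    have "(\<Sum>i = 1..DIM('e). \<Sum>j = 1..DIM('e). sq (h u (e i) (e j))) = (\<Sum>i = 1..k. \<Sum>j = 1..k. sq (h u (e i) (e j)))
       + 2 * (\<Sum>i = 1..k. sq (h u (e i) (e DIM('e)))) + sq (h u (e DIM('e)) (e DIM('e)))"
    proof -
      have "(\<Sum>j = 1..k. sq (h u (e (Suc k)) (e j))) = (\<Sum>j = 1..k. sq (h u (e j) (e (Suc k))))"
      proof (rule sum.cong)
        show "sq (h u (e (Suc k)) (e j)) = sq (h u (e j) (e (Suc k)))" for j
          using h_commute[of "e (Suc k)" "e j"] by simp
      qed simp
      then show ?thesis
        unfolding k(1) by (simp add: sum.distrib)
    qed
    moreover have "(\<Sum>i = 1..DIM('e). sq (h u (e i) (e DIM('e)))) = (\<Sum>i = 1..k. sq (h u (e i) (e DIM('e)))) + sq (h u (e DIM('e)) (e DIM('e)))"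
      unfolding k(1) by simp
    moreover have "(\<Sum>i = 1..DIM('e). sq (h u (d i) (e DIM('e)))) = (\<Sum>i = 1..DIM('e). sq (h u (e i) (e DIM('e))))"
      by (rule tangent.trace_invariant[of "\<lambda>X Y. G (f u) (h u X (e DIM('e))) (h u Y (e DIM('e)))"])
         (use d e in \<open>auto simp: bilinear_def h_simps ambient.form_simps orthonormal_basis_iff intro!: linearI\<close>)
    moreover have "(\<Sum>i = 1..DIM('e). \<Sum>j = 1..DIM('e). sq (h u (d i) (d j))) = (\<Sum>i = 1..DIM('e). \<Sum>j = 1..DIM('e). sq (h u (e i) (e j)))"
      using casorati_curvature_eq[OF d] casorati_curvature_eq[OF e(1)] by simp
    ultimately show ?thesis
      unfolding casorati_curvature_eq[OF e(2)] dim \<Phi>_def by simp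
  qed
  define S where "S = {v. g u v v = 1}"
  obtain m where m: "m > 0" "\<And>x. g u x x \<ge> m * (norm x)\<^sup>2"
    using tangent.coercive by blast
  \<comment> \<open>Coercivity bounds the squared norm by 1 / m; the cruder bound 1 + 1 / m avoids a
    square root.\<close>
  have "norm x \<le> 1 + 1 / m" if "x \<in> S" for x
  proof (rule ccontr)
    assume "\<not> norm x \<le> 1 + 1 / m"
    then have x: "norm x > 1 + 1 / m" by simp
    have "1 / m > 0" using m(1) by simp
    then have "norm x * 1 \<le> norm x * norm x"
      using x by (intro mult_left_mono) linarith+
    then have "(norm x)\<^sup>2 > 1 / m"
      using x unfolding power2_eq_square by linarith
    then show False
      using m(2)[of x] m(1) that by (simp add: S_def field_simps)
  qed
  then have "bounded S"
    by (auto simp: bounded_iff)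
  moreover have "closed S"
    unfolding S_def
    by (rule closed_Collect_eq) (intro tangent.continuous_on_form continuous_intros)+
  ultimately have "compact S"
    by (simp add: compact_eq_bounded_closed)
  moreover have "d DIM('e) \<in> S"
    using d k by (auto simp: S_def orthonormal_basis_iff tangent.orthonormal_def)
  moreover have "continuous_on S \<Phi>"
  proof -
    have "continuous_on S (h u X)" for X
      using linear_h(1) by (simp add: linear_continuous_on linear_conv_bounded_linear)
    moreover have "continuous_on S (\<lambda>v. h u v v)"
      using bounded_bilinear.continuous_on[OF _ continuous_on_id continuous_on_id] bilinear_h
      unfolding bilinear_conv_bounded_bilinear by auto
    ultimately show ?thesis
      unfolding \<Phi>_def by (intro continuous_intros ambient.continuous_on_form) auto
  qed
  ultimately obtain v where v: "v \<in> S" "\<And>w. w \<in> S \<Longrightarrow> \<Phi> v \<le> \<Phi> w"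
    using continuous_attains_inf[of S \<Phi>] by blast
  \<comment> \<open>The minimiser is put at the last index, so that the remaining members of the
    completed basis span the hyperplane normal to it.\<close>
  have "tangent.orthonormal {DIM('e)} (\<lambda>_. v)"
    using v(1) by (simp add: tangent.orthonormal_def S_def)
  from tangent.orthonormal_extend[OF _ _ this, of "{1..DIM('e)}" UNIV]
  obtain e where e: "tangent.orthonormal {1..DIM('e)} e" "e DIM('e) = v"
    using k by auto
  then have eb: "orthonormal_basis (g u) UNIV e"
    using tangent.orthonormal_spans[OF e(1), of UNIV] by (simp add: orthonormal_basis_iff)
  note hyp = basis_hyperplane[OF eb]
  show ?thesis
  proof (intro bexI ballI)
    fix L assume L: "L \<in> hyperplanes"
    then obtain b where b: "orthonormal_basis (g u) UNIV b" "orthonormal_basis (g u) L b"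
      using hyperplane_basis by blast
    have "b DIM('e) \<in> S"
      using b(1) k by (auto simp: S_def orthonormal_basis_iff tangent.orthonormal_def)
    then show "casorati_curvature (span (e ` {1..DIM('e) - 1})) G f u \<le> casorati_curvature L G f u"
      unfolding val[OF L b] val[OF hyp(1) eb hyp(2)] e(2) using v(2) by (simp add: divide_right_mono)
  qed (rule hyp(1))
qed

lemma delta_casorati_minimum:
  obtains L where "L \<in> hyperplanes" "delta_casorati G f u = casorati_mix L"
    "\<And>L'. L' \<in> hyperplanes \<Longrightarrow> casorati_mix L \<le> casorati_mix L'"
proof -
  obtain L where L: "L \<in> hyperplanes"
    "\<And>L'. L' \<in> hyperplanes \<Longrightarrow> casorati_curvature L G f u \<le> casorati_curvature L' G f u"
    using hyperplane_minimal by blast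
  have "(INF L\<in>hyperplanes. casorati_curvature L G f u) = casorati_curvature L G f u"
    by (rule cInf_eq_minimum) (use L in auto)
  then have "delta_casorati G f u = casorati_mix L"
    by (simp add: delta_casorati_def casorati_mix_def hyperplanes_def)
  moreover have "casorati_mix L \<le> casorati_mix L'" if "L' \<in> hyperplanes" for L'
    unfolding casorati_mix_def using L(2)[OF that] by (intro add_left_mono mult_left_mono) auto
  ultimately show ?thesis
    using that L(1) by blast
qed

theorem casorati_inequality: "normalized_scalar_curvature G f u \<le> delta_casorati G f u + c"
proof -
  obtain L where L: "L \<in> hyperplanes" "delta_casorati G f u = casorati_mix L"
    using delta_casorati_minimum by blast
  obtain e where e: "orthonormal_basis (g u) UNIV e" "orthonormal_basis (g u) L e"
    using hyperplane_basis[OF L(1)] by blast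
  have "casorati_mix L + c - normalized_scalar_curvature G f u \<ge> 0"
    unfolding casorati_gap[OF L(1) e] using dimension defect_nonneg
    by (intro mult_nonneg_nonneg add_nonneg_nonneg divide_nonneg_nonneg) auto
  then show ?thesis
    using L(2) by simp
qed

text \<open>A vanishing sum of squares gives the form with t = \<open>mean e\<close>. Conversely,
  taking the trace of the form forces \<open>mean e\<close> = t, since the weights sum to n +
  1.\<close>

lemma defect_eq_0_iff:
  "defect DIM('e) e + defect (DIM('e) - 1) e = 0 \<longleftrightarrow>
    (\<exists>t. \<forall>i\<in>{1..DIM('e)}. \<forall>j\<in>{1..DIM('e)}. h u (e i) (e j) = weight i j *\<^sub>R t)"
proof
  assume "defect DIM('e) e + defect (DIM('e) - 1) e = 0"
  then have "defect DIM('e) e = 0"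
    using defect_nonneg[of "DIM('e)" e] defect_nonneg[of "DIM('e) - 1" e] by linarith
  then have "\<forall>i\<in>{1..DIM('e)}. \<forall>j\<in>{1..DIM('e)}. sq (h u (e i) (e j) - weight i j *\<^sub>R mean e) = 0"
    unfolding defect_def
    by (simp add: sum_nonneg_eq_0_iff sum_nonneg ambient.form_nonneg)
  then show "\<exists>t. \<forall>i\<in>{1..DIM('e)}. \<forall>j\<in>{1..DIM('e)}. h u (e i) (e j) = weight i j *\<^sub>R t"
    by (auto simp: ambient.form_eq_0_iff)
next
  assume "\<exists>t. \<forall>i\<in>{1..DIM('e)}. \<forall>j\<in>{1..DIM('e)}. h u (e i) (e j) = weight i j *\<^sub>R t"
  then obtain t where t: "\<And>i j. i \<in> {1..DIM('e)} \<Longrightarrow> j \<in> {1..DIM('e)} \<Longrightarrow> h u (e i) (e j) = weight i j *\<^sub>R t"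
    by blast
  obtain k where k: "DIM('e) = Suc k"
    using dimension by (cases "DIM('e)") auto
  have "(\<Sum>i = 1..k. weight i i) = (\<Sum>i = 1..k. 1)"
    by (rule sum.cong) (auto simp: weight_def k)
  then have "(\<Sum>i = 1..DIM('e). weight i i) = real DIM('e) + 1"
    unfolding k by (simp add: weight_def k)
  moreover have "(\<Sum>i = 1..DIM('e). h u (e i) (e i)) = (\<Sum>i = 1..DIM('e). weight i i) *\<^sub>R t"
    using t by (simp add: scaleR_sum_left)
  ultimately have "mean e = t"
    by (simp add: mean_def)
  then have "defect m e = 0" if "m \<le> DIM('e)" for m
    unfolding defect_def using t that by (intro sum.neutral ballI) (auto simp: ambient.form_simps)
  then show "defect DIM('e) e + defect (DIM('e) - 1) e = 0"
    by simp
qed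

text \<open>Forwards, the gap vanishes at the minimising hyperplane and its adapted basis is the
  frame. Backwards, the first n - 1 members of the frame span a hyperplane of gap zero, which bounds
  the infimum from above; the inequality gives the other bound.\<close>

lemma casorati_equality_iff:
  "normalized_scalar_curvature G f u = delta_casorati G f u + c \<longleftrightarrow>
    (\<exists>e t. orthonormal_basis (g u) UNIV e \<and>
      (\<forall>i\<in>{1..DIM('e)}. \<forall>j\<in>{1..DIM('e)}. h u (e i) (e j) = weight i j *\<^sub>R t))"
proof -
  obtain L where L: "L \<in> hyperplanes" "delta_casorati G f u = casorati_mix L"
    "\<And>L'. L' \<in> hyperplanes \<Longrightarrow> casorati_mix L \<le> casorati_mix L'"
    using delta_casorati_minimum by blast
  have pos: "(real DIM('e) + 1) / (2 * real DIM('e) * (real DIM('e) - 1)) > 0"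
    using dimension by auto
  show ?thesis
  proof
    assume eq: "normalized_scalar_curvature G f u = delta_casorati G f u + c"
    obtain e where e: "orthonormal_basis (g u) UNIV e" "orthonormal_basis (g u) L e"
      using hyperplane_basis[OF L(1)] by blast
    have "defect DIM('e) e + defect (DIM('e) - 1) e = 0"
      using casorati_gap[OF L(1) e] pos eq L(2) by (smt (verit) mult_pos_pos mult_eq_0_iff)
    then show "\<exists>e t. orthonormal_basis (g u) UNIV e \<and>
      (\<forall>i\<in>{1..DIM('e)}. \<forall>j\<in>{1..DIM('e)}. h u (e i) (e j) = weight i j *\<^sub>R t)"
      using e(1) defect_eq_0_iff by blast
  next
    assume "\<exists>e t. orthonormal_basis (g u) UNIV e \<and>
      (\<forall>i\<in>{1..DIM('e)}. \<forall>j\<in>{1..DIM('e)}. h u (e i) (e j) = weight i j *\<^sub>R t)"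
    then obtain e where e: "orthonormal_basis (g u) UNIV e" "defect DIM('e) e + defect (DIM('e) - 1) e = 0"
      using defect_eq_0_iff by blast
    note hyp = basis_hyperplane[OF e(1)]
    have "casorati_mix (span (e ` {1..DIM('e) - 1})) + c - normalized_scalar_curvature G f u = 0"
      using casorati_gap[OF hyp(1) e(1) hyp(2)] e(2) by simp
    then show "normalized_scalar_curvature G f u = delta_casorati G f u + c"
      using casorati_inequality L(2) L(3)[OF hyp(1)] by linarith
  qed
qed

end

section \<open>The equality case\<close>

lemma smooth_on_differentiable: "smooth_on S f \<Longrightarrow> x \<in> S \<Longrightarrow> f differentiable (at x)"
  unfolding smooth_on_def by (metis Ck_on.simps(2))

lemma smooth_on_ddir: "smooth_on S f \<Longrightarrow> smooth_on S (\<lambda>x. ddir f x v)"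
  unfolding smooth_on_def by (metis Ck_on.simps(2))

context space_form_immersion
begin

text \<open>Expand h(e_i, e_j) in the normal frame: the coefficients are the matrix entries of the
  shape operators, so only the index n + 1 survives and t is \<open>a\<close> times that
  normal.\<close>

lemma special_shape_operators_second_fundamental_form:
  assumes "special_shape_operators G f u"
  shows "\<exists>e t. orthonormal_basis (g u) UNIV e \<and>
    (\<forall>i\<in>{1..DIM('e)}. \<forall>j\<in>{1..DIM('e)}. h u (e i) (e j) = weight i j *\<^sub>R t)"
proof -
  obtain e \<xi> a where e: "orthonormal_basis (g u) UNIV e" and \<xi>: "normal_frame G f u \<xi>"
    and a: "\<And>i. i \<in> {1..DIM('e)} \<Longrightarrow> shape_operator G f u (\<xi> (DIM('e) + 1)) (e i)
      = (if i = DIM('e) then 2 * a else a) *\<^sub>R e i"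
    and zero: "\<And>r X. r \<in> {DIM('e) + 2..DIM('f)} \<Longrightarrow> shape_operator G f u (\<xi> r) X = 0"
    using assms unfolding special_shape_operators_def by blast
  have on: "tangent.orthonormal {1..DIM('e)} e"
    using e by (simp add: orthonormal_basis_iff)
  have "h u (e i) (e j) = weight i j *\<^sub>R (a *\<^sub>R \<xi> (DIM('e) + 1))" if i: "i \<in> {1..DIM('e)}" and j: "j \<in> {1..DIM('e)}" for i j
  proof -
    have "h u (e i) (e j) = (\<Sum>r = DIM('e) + 1..DIM('f). G (f u) (h u (e i) (e j)) (\<xi> r) *\<^sub>R \<xi> r)"
      by (rule ambient.orthonormal_expansion)
         (use \<xi> second_fundamental_form_normal[OF point] in \<open>auto simp: normal_frame_iff\<close>)
    also have "\<dots> = (\<Sum>r = DIM('e) + 1..DIM('f). if r = DIM('e) + 1 then (weight i j * a) *\<^sub>R \<xi> r else 0)"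
    proof (rule sum.cong)
      fix r assume r: "r \<in> {DIM('e) + 1..DIM('f)}"
      show "G (f u) (h u (e i) (e j)) (\<xi> r) *\<^sub>R \<xi> r = (if r = DIM('e) + 1 then (weight i j * a) *\<^sub>R \<xi> r else 0)"
      proof (cases "r = DIM('e) + 1")
        case True
        then show ?thesis
          unfolding induced_shape_operator[OF point, symmetric] True a[OF i]
          using tangent.orthonormalD[OF on i j]
          by (auto simp: weight_def tangent.form_simps)
      next
        case False
        then have "r \<in> {DIM('e) + 2..DIM('f)}" using r by auto
        then show ?thesis
          unfolding induced_shape_operator[OF point, symmetric] using False
          by (simp add: zero tangent.form_simps)
      qed
    qed simp
    also have "\<dots> = (weight i j * a) *\<^sub>R \<xi> (DIM('e) + 1)"
      using codimension by simp
    finally show ?thesis by simp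
  qed
  then show ?thesis
    using e by blast
qed

end

locale equality_frame = space_form_immersion V G U f u c
  for V :: "'f::euclidean_space set" and G :: "'f metric"
    and U :: "'e::euclidean_space set" and f :: "'e \<Rightarrow> 'f" and u :: 'e and c :: real +
  fixes e :: "nat \<Rightarrow> 'e" and t :: 'f
  assumes frame: "orthonormal_basis (g u) UNIV e"
    and h_frame: "\<And>i j. i \<in> {1..DIM('e)} \<Longrightarrow> j \<in> {1..DIM('e)} \<Longrightarrow> h u (e i) (e j) = weight i j *\<^sub>R t"
begin

abbreviation "pole \<equiv> e DIM('e)"

lemma orthonormal_frame: "tangent.orthonormal {1..DIM('e)} e" "span (e ` {1..DIM('e)}) = UNIV"
  using frame by (simp_all add: orthonormal_basis_iff)

lemma pole_unit: "g u pole pole = 1"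
  using tangent.orthonormalD[OF orthonormal_frame(1), of "DIM('e)" "DIM('e)"] dimension by simp

text \<open>D is the identity plus a second unit in the direction of \<open>pole\<close>. This
  frame-free form makes every shape operator a multiple of one operator.\<close>

lemma h_eq: "h u X Y = (g u X Y + g u X pole * g u Y pole) *\<^sub>R t"
proof -
  have lin: "linear (\<lambda>X. (g u X Y + g u X pole * g u Y pole) *\<^sub>R t)" for Y
    by (auto intro!: linearI simp: tangent.form_simps algebra_simps)
  have lin': "linear (\<lambda>Y. (g u X Y + g u X pole * g u Y pole) *\<^sub>R t)" for X
    by (auto intro!: linearI simp: tangent.form_simps algebra_simps)
  have "h u (e i) (e j) = (g u (e i) (e j) + g u (e i) pole * g u (e j) pole) *\<^sub>R t"
    if "i \<in> {1..DIM('e)}" "j \<in> {1..DIM('e)}" for i j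
    using h_frame[OF that] tangent.orthonormalD[OF orthonormal_frame(1)] that dimension
    by (auto simp: weight_def)
  then have "h u X (e j) = (g u X (e j) + g u X pole * g u (e j) pole) *\<^sub>R t"
    if "j \<in> {1..DIM('e)}" for X j
    by (rule_tac linear_eq_on_span[OF linear_h(2) lin, of "e ` {1..DIM('e)}"])
       (use that orthonormal_frame(2) in auto)
  then show ?thesis
    by (rule_tac linear_eq_on_span[OF linear_h(1) lin', of "e ` {1..DIM('e)}"])
       (use orthonormal_frame(2) in auto)
qed

lemma shape_operator_eq: "shape_operator G f u \<xi> X = G (f u) t \<xi> *\<^sub>R (X + g u X pole *\<^sub>R pole)"
proof (rule shape_operator_eqI[OF point])
  show "g u (G (f u) t \<xi> *\<^sub>R (X + g u X pole *\<^sub>R pole)) Y = G (f u) (h u X Y) \<xi>" for Y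
    using tangent.form_commute[of pole Y] unfolding h_eq
    by (simp add: tangent.form_simps ambient.form_simps)
qed

lemma t_normal: "t \<in> normal_space G f u"
proof -
  \<comment> \<open>As n >= 2, index 1 is not the last one and has weight 1.\<close>
  have "h u (e 1) (e 1) = t"
    using h_frame[of 1 1] dimension by (auto simp: weight_def)
  then show ?thesis
    using second_fundamental_form_normal[OF point, of "e 1" "e 1"] by simp
qed

lemma adapted_normal_frame:
  obtains \<xi> a where "normal_frame G f u \<xi>" "t = a *\<^sub>R \<xi> (DIM('e) + 1)"
proof (cases "t = 0")
  case True
  then show ?thesis
    using normal_frame_exists that[of _ 0] by auto
next
  case False
  define z where "z = (1 / sqrt (sq t)) *\<^sub>R t"
  have s: "sq t > 0"
    by (rule ambient.form_pos[OF False])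
  then have "sq z = 1"
    by (simp add: z_def ambient.form_simps flip: power2_eq_square)
  then have "ambient.orthonormal {DIM('e) + 1} (\<lambda>_. z)"
    by (simp add: ambient.orthonormal_def)
  moreover have "z \<in> normal_space G f u"
    using t_normal subspace_normal_space by (simp add: z_def subspace_mul)
  ultimately obtain \<xi> where \<xi>: "normal_frame G f u \<xi>" "\<xi> (DIM('e) + 1) = z"
    using normal_frame_extend[of "{DIM('e) + 1}" "\<lambda>_. z"] codimension by auto
  moreover have "t = sqrt (sq t) *\<^sub>R z"
    using s by (simp add: z_def)
  ultimately show ?thesis
    using that by metis
qed

lemma special_shape_operators_holds: "special_shape_operators G f u"
proof -
  obtain \<xi> a where \<xi>: "normal_frame G f u \<xi>" and t: "t = a *\<^sub>R \<xi> (DIM('e) + 1)"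
    by (rule adapted_normal_frame)
  have on: "ambient.orthonormal {DIM('e) + 1..DIM('f)} \<xi>"
    using \<xi> by (simp add: normal_frame_iff)
  have inner_t: "G (f u) t (\<xi> r) = (if r = DIM('e) + 1 then a else 0)" if "r \<in> {DIM('e) + 1..DIM('f)}" for r
    using ambient.orthonormalD[OF on, of "DIM('e) + 1" r] that codimension
    by (auto simp: t ambient.form_simps)
  have "shape_operator G f u (\<xi> (DIM('e) + 1)) (e i) = (if i = DIM('e) then 2 * a else a) *\<^sub>R e i"
    if "i \<in> {1..DIM('e)}" for i
    using inner_t[of "DIM('e) + 1"] codimension that pole_unit
      tangent.orthonormalD[OF orthonormal_frame(1), of i "DIM('e)"]
    by (auto simp: shape_operator_eq scaleR_2[symmetric])
  moreover have "shape_operator G f u (\<xi> r) X = 0" if "r \<in> {DIM('e) + 2..DIM('f)}" for r X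
    using inner_t[of r] that by (simp add: shape_operator_eq)
  ultimately show ?thesis
    unfolding special_shape_operators_def using frame \<xi> by blast
qed

text \<open>Any normal frame will do: all shape operators are multiples of the same operator, which
  fixes the complement of \<open>pole\<close> and doubles \<open>pole\<close>.\<close>

lemma invariantly_quasi_umbilical_holds: "invariantly_quasi_umbilical G f u"
proof -
  obtain \<xi> where \<xi>: "normal_frame G f u \<xi>"
    using normal_frame_exists by blast
  have "\<exists>a b. DIM('e) - 1 \<le> dim {X. shape_operator G f u (\<xi> r) X = a *\<^sub>R X} \<and>
      {X. g u X pole = 0} \<subseteq> {X. shape_operator G f u (\<xi> r) X = a *\<^sub>R X} \<and>
      shape_operator G f u (\<xi> r) pole = b *\<^sub>R pole" for r
  proof (intro exI conjI)
    let ?E = "{X. shape_operator G f u (\<xi> r) X = G (f u) t (\<xi> r) *\<^sub>R X}"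
    show sub: "{X. g u X pole = 0} \<subseteq> ?E"
      by (auto simp: shape_operator_eq)
    have "e ` {1..DIM('e) - 1} \<subseteq> {X. g u X pole = 0}"
    proof
      fix x assume "x \<in> e ` {1..DIM('e) - 1}"
      then obtain i where "i \<in> {1..DIM('e) - 1}" "x = e i" by blast
      then show "x \<in> {X. g u X pole = 0}"
        using tangent.orthonormalD[OF orthonormal_frame(1), of i "DIM('e)"] dimension by auto
    qed
    then have "dim (span (e ` {1..DIM('e) - 1})) \<le> dim ?E"
      using sub dim_subset[of "e ` {1..DIM('e) - 1}" ?E] by auto
    then show "DIM('e) - 1 \<le> dim ?E"
      using basis_hyperplane(1)[OF frame] by (simp add: hyperplanes_def)
    show "shape_operator G f u (\<xi> r) pole = (2 * G (f u) t (\<xi> r)) *\<^sub>R pole"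
      by (simp add: shape_operator_eq pole_unit scaleR_2[symmetric] mult.commute)
  qed
  moreover have "pole \<noteq> 0"
    using pole_unit by (auto simp: tangent.form_simps)
  ultimately show ?thesis
    unfolding invariantly_quasi_umbilical_def using \<xi> by blast
qed

text \<open>Both contributions to the Ricci equation vanish: the ambient curvature of two tangent
  vectors kills a normal vector in constant curvature, and the shape operators commute.\<close>

lemma normal_curvature_vanishes_holds: "normal_curvature_vanishes G f u"
  unfolding normal_curvature_vanishes_def
proof (intro allI impI, elim conjE)
  fix N \<xi> X Y
  assume N: "open N" "u \<in> N" and sm: "smooth_on N \<xi>" and \<xi>: "\<forall>w\<in>N. \<xi> w \<in> normal_space G f w"
  have orth: "G (f u) (ddir f u Z) (\<xi> u) = 0" for Z
    using normal_spaceD[of "\<xi> u" u Z] \<xi> N(2) ambient.form_commute by simp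
  have "curvature G (f u) (ddir f u X) (ddir f u Y) (\<xi> u) = 0"
    by (rule ambient.form_eqI)
       (simp add: constant_sectional_curvature[OF maps[OF point] sectional] orth ambient.form_simps)
  moreover have "normal_curvature G f X Y \<xi> u =
    normal_part G f u (curvature G (f u) (ddir f u X) (ddir f u Y) (\<xi> u))
    + h u X (shape_operator G f u (\<xi> u) Y) - h u Y (shape_operator G f u (\<xi> u) X)"
    by (rule ricci_equation[OF point N])
       (use sm \<xi> in \<open>auto intro: smooth_on_differentiable smooth_on_ddir\<close>)
  \<comment> \<open>Up to the factor \<open>G (f u) t (\<xi> u)\<close>, both sides equal (g(X, Y) +
    3 g(X, pole) g(Y, pole)) t.\<close>
  moreover have "h u X (shape_operator G f u (\<xi> u) Y) = h u Y (shape_operator G f u (\<xi> u) X)"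
    unfolding h_eq shape_operator_eq using tangent.form_commute[of Y X]
    by (simp add: tangent.form_simps pole_unit algebra_simps)
  ultimately show "normal_curvature G f X Y \<xi> u = 0"
    by (simp add: linear_0[OF linear_normal_part[OF point]])
qed

end

context space_form_immersion
begin

theorem casorati_equality_characterization:
  "normalized_scalar_curvature G f u = delta_casorati G f u + c \<longleftrightarrow>
    invariantly_quasi_umbilical G f u \<and> normal_curvature_vanishes G f u \<and> special_shape_operators G f u"
proof
  assume "normalized_scalar_curvature G f u = delta_casorati G f u + c"
  then obtain e t where "orthonormal_basis (g u) UNIV e"
    "\<forall>i\<in>{1..DIM('e)}. \<forall>j\<in>{1..DIM('e)}. h u (e i) (e j) = weight i j *\<^sub>R t"
    unfolding casorati_equality_iff by blast
  then interpret equality_frame V G U f u c e t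
    by unfold_locales auto
  show "invariantly_quasi_umbilical G f u \<and> normal_curvature_vanishes G f u \<and> special_shape_operators G f u"
    using invariantly_quasi_umbilical_holds normal_curvature_vanishes_holds special_shape_operators_holds
    by blast
next
  assume "invariantly_quasi_umbilical G f u \<and> normal_curvature_vanishes G f u \<and> special_shape_operators G f u"
  then show "normalized_scalar_curvature G f u = delta_casorati G f u + c"
    unfolding casorati_equality_iff using special_shape_operators_second_fundamental_form by blast
qed

end

section \<open>Submanifolds of real space forms\<close>

lemma metric_patch_if_local_riemannian_metric:
  assumes "open V" "local_riemannian_metric V G"
  shows "metric_patch V G"
proof (rule metric_patch.intro)
  have G: "\<forall>y\<in>V. bilinear (G y) \<and> (\<forall>X Y. G y X Y = G y Y X) \<and> (\<forall>X. X \<noteq> 0 \<longrightarrow> G y X X > 0)"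
    and sm: "smooth_on V (\<lambda>y. G y X Y)" for X Y
    using assms(2) by (auto simp: local_riemannian_metric_def)
  show "inner_form (G y)" if "y \<in> V" for y
    using G that by (simp add: inner_form_def)
  show "(\<lambda>q. G q X Y) differentiable at y" if "y \<in> V" for X Y y
    by (rule smooth_on_differentiable[OF sm that])
  show "(\<lambda>q. ddir (\<lambda>q. G q X Y) q Z) differentiable at y" if "y \<in> V" for X Y Z y
    by (rule smooth_on_differentiable[OF smooth_on_ddir[OF sm] that])
qed (rule assms(1))

lemma chart_at_mem:
  assumes "smooth_atlas A"
  shows "chart_at A x \<in> A" "x \<in> fst (chart_at A x)"
proof -
  have "\<exists>c. c \<in> A \<and> x \<in> fst c"
    using assms unfolding smooth_atlas_def by blast
  from someI_ex[OF this] show "chart_at A x \<in> A" "x \<in> fst (chart_at A x)"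
    unfolding chart_at_def by auto
qed

text \<open>The domain is the chart image of the points that \<open>F\<close> maps into the chosen
  ambient chart; it is open because \<open>F\<close> is continuous and the chart is a
  homeomorphism.\<close>

lemma space_form_immersion_at_point:
  fixes A :: "('m::topological_space, 'e::euclidean_space) chart set"
    and B :: "('w::topological_space, 'f::euclidean_space) chart set"
  assumes A: "smooth_atlas A" and B: "real_space_form B G c" and F: "smooth_immersion A B F"
    and dim: "DIM('e) \<ge> 2" "DIM('e) < DIM('f)"
  obtains V U where
    "space_form_immersion V (G (chart_at B (F x))) U (local_rep A B F x) (coords A x) c"
proof -
  define a where "a = chart_at A x"
  define d where "d = chart_at B (F x)"
  define U where "U = snd a ` (fst a \<inter> F -` fst d)"
  define V where "V = snd d ` fst d"
  have B': "smooth_atlas B" "riemannian_metric B G"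
    using B by (auto simp: real_space_form_def)
  have a: "a \<in> A" "x \<in> fst a" and d: "d \<in> B" "F x \<in> fst d"
    unfolding a_def d_def by (rule chart_at_mem[OF A] chart_at_mem[OF B'(1)])+
  have a': "open (fst a)" "open (snd a ` fst a)" "homeomorphism (fst a) (snd a ` fst a) (snd a) (chart_inv a)"
    using A a(1) by (auto simp: smooth_atlas_def)
  have d': "open (fst d)" "open V"
    using B'(1) d(1) by (auto simp: smooth_atlas_def V_def)
  have inv: "chart_inv a (snd a y) = y" if "y \<in> fst a" for y
    by (rule homeomorphism_apply1[OF a'(3) that])
  have f: "local_rep A B F x = snd d \<circ> F \<circ> chart_inv a"
    by (simp add: local_rep_def a_def d_def)
  have u: "coords A x = snd a x"
    by (simp add: coords_def a_def)
  have "open (fst a \<inter> F -` fst d)"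
    using F d'(1) a'(1) by (auto simp: smooth_immersion_def intro!: open_Int open_vimage)
  then have "openin (top_of_set (fst a)) (fst a \<inter> F -` fst d)"
    by (simp add: openin_open_eq a'(1))
  from homeomorphism_imp_open_map[OF a'(3) this] have U: "open U"
    using a'(2) by (simp add: U_def openin_open_eq)
  have imm: "smooth_on U (local_rep A B F x)" "\<forall>w\<in>U. inj (ddir (local_rep A B F x) w)"
    using F a(1) d(1) by (auto simp: smooth_immersion_def Let_def f U_def)
  interpret metric_patch V "G d"
    by (rule metric_patch_if_local_riemannian_metric[OF d'(2)])
       (use B'(2) d(1) in \<open>simp add: riemannian_metric_def V_def\<close>)
  have "space_form_immersion V (G d) U (local_rep A B F x) (coords A x) c"
  proof unfold_locales
    show "open U" by (rule U)
    show "local_rep A B F x w \<in> V" if "w \<in> U" for w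
      using that inv by (auto simp: f U_def V_def)
    show "local_rep A B F x differentiable at w" if "w \<in> U" for w
      by (rule smooth_on_differentiable[OF imm(1) that])
    show "(\<lambda>w. ddir (local_rep A B F x) w X) differentiable at w" if "w \<in> U" for w X
      by (rule smooth_on_differentiable[OF smooth_on_ddir[OF imm(1)] that])
    show "(\<lambda>w. ddir (\<lambda>w. ddir (local_rep A B F x) w X) w Y) differentiable at w" if "w \<in> U" for w X Y
      by (rule smooth_on_differentiable[OF smooth_on_ddir[OF smooth_on_ddir[OF imm(1)]] that])
    show "inj (ddir (local_rep A B F x) w)" if "w \<in> U" for w
      using imm(2) that by blast
    show "coords A x \<in> U"
      using a(2) d(2) by (auto simp: u U_def)
    \<comment> \<open>\<open>real_space_form\<close> states the curvature at a point in the chart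
      selected for that same point; this identifies the two base points.\<close>
    have "local_rep A B F x (coords A x) = coords B (F x)"
      unfolding f u by (simp add: coords_def d_def inv[OF a(2)])
    then show "sectional_curvature (G d) (local_rep A B F x (coords A x)) X Y = c"
      if "X \<noteq> Y" "independent {X, Y}" for X Y
      using B that by (simp add: real_space_form_def d_def)
  qed (use dim in auto)
  then show ?thesis
    using that by (simp add: d_def)
qed

theorem theorem4p1:
  fixes A :: "('m::{t2_space, second_countable_topology}, 'e::euclidean_space) chart set"
    and B :: "('w::{t2_space, second_countable_topology}, 'f::euclidean_space) chart set"
    and G :: "('w, 'f) chart \<Rightarrow> 'f metric"
    and F :: "'m \<Rightarrow> 'w"
    and c :: real and n p :: nat
  assumes "DIM('e) = n" and "DIM('f) = n + p" and "n \<ge> 3" and "p \<ge> 1"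
    and "smooth_atlas A"
    and "real_space_form B G c"
    and "smooth_immersion A B F"
  shows "(\<forall>x. at_point A B G F normalized_scalar_curvature x
                \<le> at_point A B G F delta_casorati x + c) \<and>
    ((\<forall>x. at_point A B G F normalized_scalar_curvature x
                = at_point A B G F delta_casorati x + c) \<longleftrightarrow>
      (\<forall>x. at_point A B G F invariantly_quasi_umbilical x) \<and>
      (\<forall>x. at_point A B G F normal_curvature_vanishes x) \<and>
      (\<forall>x. at_point A B G F special_shape_operators x))"
proof -
  \<comment> \<open>The equivalence already holds at each point separately.\<close>
  have "at_point A B G F normalized_scalar_curvature x \<le> at_point A B G F delta_casorati x + c \<and>
    (at_point A B G F normalized_scalar_curvature x = at_point A B G F delta_casorati x + c \<longleftrightarrow>
      at_point A B G F invariantly_quasi_umbilical x \<and> at_point A B G F normal_curvature_vanishes x \<and>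
      at_point A B G F special_shape_operators x)" for x
  proof -
    obtain V U where "space_form_immersion V (G (chart_at B (F x))) U (local_rep A B F x) (coords A x) c"
      by (rule space_form_immersion_at_point[OF assms(5-7)]) (use assms(1-4) in auto)
    then interpret space_form_immersion V "G (chart_at B (F x))" U "local_rep A B F x" "coords A x" c .
    show ?thesis
      unfolding at_point_def using casorati_inequality casorati_equality_characterization by blast
  qed
  then show ?thesis by blast
qed

end
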